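(* Every minimal unordered field is algebraically closed.
   Context: An infinite first-order structure $M$ is minimal if every subset of $M$ definable in $M$ with parameters is finite or co-finite. A minimal field is a minimal structure which is a field, possibly with additional first-order structure. A structure $M$ is ordered if there is a strict partial order on $M$ (on singletons) which is definable in $M$ with parameters but is not definable (with parameters) from equality alone; otherwise $M$ is unordered. (These are not ordered fields in the usual algebraic sense.) *)

theory Defs
  imports "HOL-Computational_Algebra.Computational_Algebra"
begin

datatype 'f fo_term = Var nat | Fun 'f "'f fo_term list"

datatype ('f, 'r) fo_form =
    Eq "'f fo_term" "'f fo_term"
  | Rel 'r "'f fo_term list"
  | Neg "('f, 'r) fo_form"
  | Conj "('f, 'r) fo_form" "('f, 'r) fo_form"
  | Exists nat "('f, 'r) fo_form"

text \<open>
  The universe of a structure is the whole type \<open>'a\<close>.  Its language consists of the pairs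
  (symbol, arity) in \<open>fun_syms\<close> and \<open>rel_syms\<close>; the values of an interpretation at symbols
  outside these sets, or at lists of the wrong length, are irrelevant, because only formulas of
  the language are used below.
\<close>

record ('a, 'f, 'r) fo_structure =
  fun_syms :: "('f \<times> nat) set"
  rel_syms :: "('r \<times> nat) set"
  fun_interp :: "'f \<Rightarrow> 'a list \<Rightarrow> 'a"
  rel_interp :: "'r \<Rightarrow> 'a list \<Rightarrow> bool"

primrec term_in :: "('f \<times> nat) set \<Rightarrow> 'f fo_term \<Rightarrow> bool" where
  "term_in F (Var n) \<longleftrightarrow> True"
| "term_in F (Fun f ts) \<longleftrightarrow> (f, length ts) \<in> F \<and> list_all (\<lambda>b. b) (map (term_in F) ts)"

primrec form_in :: "('f \<times> nat) set \<Rightarrow> ('r \<times> nat) set \<Rightarrow> ('f, 'r) fo_form \<Rightarrow> bool" where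
  "form_in F P (Eq s t) \<longleftrightarrow> term_in F s \<and> term_in F t"
| "form_in F P (Rel r ts) \<longleftrightarrow> (r, length ts) \<in> P \<and> list_all (term_in F) ts"
| "form_in F P (Neg \<phi>) \<longleftrightarrow> form_in F P \<phi>"
| "form_in F P (Conj \<phi> \<psi>) \<longleftrightarrow> form_in F P \<phi> \<and> form_in F P \<psi>"
| "form_in F P (Exists n \<phi>) \<longleftrightarrow> form_in F P \<phi>"

abbreviation formula_of :: "('a, 'f, 'r) fo_structure \<Rightarrow> ('f, 'r) fo_form \<Rightarrow> bool" where
  "formula_of M \<equiv> form_in (fun_syms M) (rel_syms M)"

primrec term_val :: "('a, 'f, 'r) fo_structure \<Rightarrow> (nat \<Rightarrow> 'a) \<Rightarrow> 'f fo_term \<Rightarrow> 'a" where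
  "term_val M e (Var n) = e n"
| "term_val M e (Fun f ts) = fun_interp M f (map (term_val M e) ts)"

primrec sat :: "('a, 'f, 'r) fo_structure \<Rightarrow> (nat \<Rightarrow> 'a) \<Rightarrow> ('f, 'r) fo_form \<Rightarrow> bool" where
  "sat M e (Eq s t) \<longleftrightarrow> term_val M e s = term_val M e t"
| "sat M e (Rel r ts) \<longleftrightarrow> rel_interp M r (map (term_val M e) ts)"
| "sat M e (Neg \<phi>) \<longleftrightarrow> \<not> sat M e \<phi>"
| "sat M e (Conj \<phi> \<psi>) \<longleftrightarrow> sat M e \<phi> \<and> sat M e \<psi>"
| "sat M e (Exists n \<phi>) \<longleftrightarrow> (\<exists>x. sat M (e(n := x)) \<phi>)"

text \<open>
  Definability with parameters: the values of the assignment \<open>e\<close> at the finitely many variables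
  of \<open>\<phi>\<close> other than 0 (for sets), or other than 0 and 1 (for binary relations), are the
  parameters.
\<close>

definition definable_set :: "('a, 'f, 'r) fo_structure \<Rightarrow> 'a set \<Rightarrow> bool" where
  "definable_set M A \<longleftrightarrow>
     (\<exists>\<phi> e. formula_of M \<phi> \<and> A = {x. sat M (e(0 := x)) \<phi>})"

definition definable_rel :: "('a, 'f, 'r) fo_structure \<Rightarrow> ('a \<times> 'a) set \<Rightarrow> bool" where
  "definable_rel M R \<longleftrightarrow>
     (\<exists>\<phi> e. formula_of M \<phi> \<and> R = {(x, y). sat M (e(0 := x, 1 := y)) \<phi>})"

definition minimal_structure :: "('a, 'f, 'r) fo_structure \<Rightarrow> bool" where
  "minimal_structure M \<longleftrightarrow>
     infinite (UNIV :: 'a set) \<and> (\<forall>A. definable_set M A \<longrightarrow> finite A \<or> finite (- A))"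

text \<open>The reduct to the empty language, in which only equality is available.\<close>

definition equality_reduct :: "('a, 'f, 'r) fo_structure \<Rightarrow> ('a, 'f, 'r) fo_structure" where
  "equality_reduct M = M\<lparr>fun_syms := {}, rel_syms := {}\<rparr>"

definition ordered_structure :: "('a, 'f, 'r) fo_structure \<Rightarrow> bool" where
  "ordered_structure M \<longleftrightarrow>
     (\<exists>R. irrefl R \<and> trans R \<and> definable_rel M R \<and> \<not> definable_rel (equality_reduct M) R)"

text \<open>
  The language contains symbols for the addition and multiplication of the field \<open>'a\<close>, and
  possibly further symbols with arbitrary interpretations.  Symbols for zero, one and negation are
  allowed but need not be required: these are definable from addition and multiplication.
\<close>

definition field_structure :: "('a :: field, 'f, 'r) fo_structure \<Rightarrow> bool" where
  "field_structure M \<longleftrightarrow>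
     (\<exists>p. (p, 2) \<in> fun_syms M \<and> (\<forall>x y. fun_interp M p [x, y] = x + y)) \<and>
     (\<exists>t. (t, 2) \<in> fun_syms M \<and> (\<forall>x y. fun_interp M t [x, y] = x * y))"

definition minimal_field :: "('a :: field, 'f, 'r) fo_structure \<Rightarrow> bool" where
  "minimal_field M \<longleftrightarrow> minimal_structure M \<and> field_structure M"

end

theory Submission
  imports Defs
begin

text \<open>
  In an infinite minimal group ``for almost all \<open>x\<close>'' (all but finitely many) is first-order
  definable: a definable set is cofinite iff it and one of its translates cover the group.
  If there is no definable order, this quantifier commutes with itself in definable predicates,
  and this yields a dimension theory in which no definable relation between \<open>K^n\<close> and \<open>K^m\<close>,
  \<open>m < n\<close>, with finite fibres over \<open>K^m\<close> projects onto almost all of \<open>K^n\<close>.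

  Suppose \<open>f\<close> is a polynomial without roots of minimal degree \<open>n \<ge> 2\<close>, and let
  \<open>L = K[X]/(f)\<close>, a copy of \<open>K^n\<close>.  Every element of \<open>L - K\<close> is annihilated by a monic polynomial
  of degree \<open>n\<close> without roots in \<open>K\<close>.  Relate it to the \<open>n - 1\<close> coefficients of this polynomial
  other than the constant one.  A nonconstant polynomial map \<open>K \<rightarrow> K\<close> has
  infinite, hence cofinite, image, so these \<open>n - 1\<close> coefficients leave only finitely many choices
  for the constant coefficient.  Thus all fibres are finite, a contradiction.
\<close>

section \<open>Definable predicates\<close>

primrec rename_term :: "(nat \<Rightarrow> nat) \<Rightarrow> 'f fo_term \<Rightarrow> 'f fo_term" where
  "rename_term r (Var n) = Var (r n)"
| "rename_term r (Fun f ts) = Fun f (map (rename_term r) ts)"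

primrec rename_form :: "(nat \<Rightarrow> nat) \<Rightarrow> ('f, 'r) fo_form \<Rightarrow> ('f, 'r) fo_form" where
  "rename_form r (Eq s t) = Eq (rename_term r s) (rename_term r t)"
| "rename_form r (Rel R ts) = Rel R (map (rename_term r) ts)"
| "rename_form r (Neg \<phi>) = Neg (rename_form r \<phi>)"
| "rename_form r (Conj \<phi> \<psi>) = Conj (rename_form r \<phi>) (rename_form r \<psi>)"
| "rename_form r (Exists n \<phi>) = Exists (r n) (rename_form r \<phi>)"

primrec term_vars :: "'f fo_term \<Rightarrow> nat set" where
  "term_vars (Var n) = {n}"
| "term_vars (Fun f ts) = \<Union> (set (map term_vars ts))"

primrec form_vars :: "('f, 'r) fo_form \<Rightarrow> nat set" where
  "form_vars (Eq s t) = term_vars s \<union> term_vars t"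
| "form_vars (Rel R ts) = \<Union> (term_vars ` set ts)"
| "form_vars (Neg \<phi>) = form_vars \<phi>"
| "form_vars (Conj \<phi> \<psi>) = form_vars \<phi> \<union> form_vars \<psi>"
| "form_vars (Exists n \<phi>) = insert n (form_vars \<phi>)"

lemma finite_term_vars: "finite (term_vars t)"
  by (induction t) auto

lemma finite_form_vars: "finite (form_vars \<phi>)"
  by (induction \<phi>) (auto simp: finite_term_vars)

lemma term_val_cong:
  "(\<And>n. n \<in> term_vars t \<Longrightarrow> e n = e' n) \<Longrightarrow> term_val M e t = term_val M e' t"
proof (induction t)
  case (Fun f ts)
  then have "map (term_val M e) ts = map (term_val M e') ts"
    by (intro map_cong refl) (auto intro!: Fun.IH Fun.prems)
  then show ?case by (simp cong: map_cong)
qed simp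

lemma sat_cong:
  "(\<And>n. n \<in> form_vars \<phi> \<Longrightarrow> e n = e' n) \<Longrightarrow> sat M e \<phi> \<longleftrightarrow> sat M e' \<phi>"
proof (induction \<phi> arbitrary: e e')
  case (Eq s t)
  then show ?case using term_val_cong[of s e e' M] term_val_cong[of t e e' M] by auto
next
  case (Rel R ts)
  then have "map (term_val M e) ts = map (term_val M e') ts"
    by (intro map_cong refl term_val_cong) auto
  then show ?case by (simp cong: map_cong)
next
  case (Neg \<phi>)
  then show ?case by (metis form_vars.simps(3) sat.simps(3))
next
  case (Conj \<phi> \<psi>)
  then show ?case by (metis UnCI form_vars.simps(4) sat.simps(4))
next
  case (Exists n \<phi>)
  have "sat M (e(n := x)) \<phi> \<longleftrightarrow> sat M (e'(n := x)) \<phi>" for x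
    by (rule Exists.IH) (use Exists.prems in auto)
  then show ?case by simp
qed

lemma term_val_rename: "term_val M e (rename_term r t) = term_val M (\<lambda>n. e (r n)) t"
proof (induction t)
  case (Fun f ts)
  then have "map (\<lambda>t. term_val M e (rename_term r t)) ts = map (term_val M (\<lambda>n. e (r n))) ts"
    by (intro map_cong refl) auto
  then show ?case by (simp only: rename_term.simps term_val.simps map_map comp_def)
qed simp

lemma term_in_rename: "term_in F (rename_term r t) \<longleftrightarrow> term_in F t"
  by (induction t) (auto simp: list_all_iff)

lemma form_in_rename: "form_in F P (rename_form r \<phi>) \<longleftrightarrow> form_in F P \<phi>"
  by (induction \<phi>) (auto simp: term_in_rename list_all_iff)

text \<open>Bound variables are renamed along with the free ones. Injectivity of \<open>r\<close>
  prevents capture: an update at \<open>r n\<close> is seen, after composition with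
  \<open>r\<close>, only at \<open>n\<close>.\<close>

lemma sat_rename:
  "inj r \<Longrightarrow> sat M e (rename_form r \<phi>) \<longleftrightarrow> sat M (\<lambda>n. e (r n)) \<phi>"
proof (induction \<phi> arbitrary: e)
  case (Exists n \<phi>)
  have "(\<lambda>m. (e(r n := x)) (r m)) = (\<lambda>m. e (r m))(n := x)" for x
    using Exists.prems by (auto simp: fun_eq_iff inj_def)
  then show ?case using Exists by simp
qed (auto simp: term_val_rename comp_def)

section \<open>Definability from equality alone\<close>

lemma sat_equality_reduct:
  assumes "formula_of (equality_reduct M) \<phi>" "bij h"
  shows "sat (equality_reduct M) (\<lambda>n. h (e n)) \<phi> \<longleftrightarrow> sat (equality_reduct M) e \<phi>"
  using assms(1)
proof (induction \<phi> arbitrary: e)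
  case (Eq s t)
  \<comment> \<open>In the empty language the only terms are variables, so every equational atom
    compares two variables, and a bijection \<open>h\<close> preserves and reflects it.\<close>
  then obtain i j where "s = Var i" "t = Var j"
    by (cases s; cases t) (auto simp: equality_reduct_def)
  then show ?case using assms(2) by (simp add: bij_def inj_eq)
next
  case (Rel R ts)
  then show ?case by (simp add: equality_reduct_def)
next
  case (Exists n \<phi>)
  have *: "(\<lambda>m. h (e m))(n := h x) = (\<lambda>m. h ((e(n := x)) m))" for x by auto
  have IH: "sat (equality_reduct M) (\<lambda>m. h ((e(n := x)) m)) \<phi>
      \<longleftrightarrow> sat (equality_reduct M) (e(n := x)) \<phi>" for x
    by (rule Exists.IH) (use Exists.prems in simp)
  have "(\<exists>x. sat (equality_reduct M) ((\<lambda>m. h (e m))(n := x)) \<phi>)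
    \<longleftrightarrow> (\<exists>x. sat (equality_reduct M) ((\<lambda>m. h (e m))(n := h x)) \<phi>)"
    using assms(2) by (metis bij_pointE)
  also have "\<dots> \<longleftrightarrow> (\<exists>x. sat (equality_reduct M) (e(n := x)) \<phi>)"
    by (simp only: * IH)
  finally show ?case by simp
qed auto

text \<open>The transposition of two elements outside \<open>A\<close>, the set of values of
  \<open>e\<close> at the variables of the formula, moves no parameter. A formula in equality alone
  cannot detect it, so \<open>x\<close> and \<open>y\<close> may be interchanged.\<close>

lemma equality_definable_symmetric:
  assumes "definable_rel (equality_reduct M) R"
  obtains A where "finite A" "\<And>x y. x \<notin> A \<Longrightarrow> y \<notin> A \<Longrightarrow> (x, y) \<in> R \<Longrightarrow> (y, x) \<in> R"
proof -
  obtain \<phi> e where \<phi>: "formula_of (equality_reduct M) \<phi>"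
    and R: "R = {(x, y). sat (equality_reduct M) (e(0 := x, 1 := y)) \<phi>}"
    using assms unfolding definable_rel_def by blast
  define A where "A = e ` form_vars \<phi>"
  have "(y, x) \<in> R" if xy: "x \<notin> A" "y \<notin> A" "(x, y) \<in> R" for x y
  proof -
    define h where "h = id(x := y, y := x)"
    have "bij h" by (rule involuntory_imp_bij) (auto simp: h_def)
    have "sat (equality_reduct M) (e(0 := x, 1 := y)) \<phi>"
      using xy(3) by (simp add: R)
    then have "sat (equality_reduct M) (\<lambda>n. h ((e(0 := x, 1 := y)) n)) \<phi>"
      by (subst sat_equality_reduct[OF \<phi> \<open>bij h\<close>, of "e(0 := x, 1 := y)"])
    moreover have "sat (equality_reduct M) (\<lambda>n. h ((e(0 := x, 1 := y)) n)) \<phi>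
        \<longleftrightarrow> sat (equality_reduct M) (e(0 := y, 1 := x)) \<phi>"
    proof (rule sat_cong)
      fix n assume "n \<in> form_vars \<phi>"
      then have "e n \<noteq> x" "e n \<noteq> y" using xy by (auto simp: A_def)
      then show "h ((e(0 := x, 1 := y)) n) = (e(0 := y, 1 := x)) n" by (auto simp: h_def)
    qed
    ultimately show ?thesis by (simp add: R)
  qed
  moreover have "finite A" by (simp add: A_def finite_form_vars)
  ultimately show ?thesis using that by blast
qed

text \<open>
  The even variables of the formula are the variables of the predicate, the odd ones carry
  parameters.
\<close>

definition with_params :: "(nat \<Rightarrow> 'a) \<Rightarrow> (nat \<Rightarrow> 'a) \<Rightarrow> nat \<Rightarrow> 'a" where
  "with_params c e n = (if even n then e (n div 2) else c (n div 2))"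

text \<open>A predicate on whole assignments, of which only finitely many coordinates matter.
  Quantifying over variable \<open>i\<close> becomes quantifying over updates at \<open>i\<close>,
  so that formulas can stay hidden behind closure lemmas.\<close>

definition definable_pred ::
    "('a, 'f, 'r) fo_structure \<Rightarrow> ((nat \<Rightarrow> 'a) \<Rightarrow> bool) \<Rightarrow> bool" where
  "definable_pred M P \<longleftrightarrow>
     (\<exists>\<phi> c. formula_of M \<phi> \<and> (\<forall>e. P e \<longleftrightarrow> sat M (with_params c e) \<phi>))"

definition definable_fun ::
    "('a, 'f, 'r) fo_structure \<Rightarrow> ((nat \<Rightarrow> 'a) \<Rightarrow> 'a) \<Rightarrow> bool" where
  "definable_fun M t \<longleftrightarrow>
     (\<exists>s c. term_in (fun_syms M) s \<and> (\<forall>e. t e = term_val M (with_params c e) s))"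

lemma with_params_upd: "with_params c (e(i := x)) = (with_params c e)(2 * i := x)"
  by (auto simp: with_params_def fun_eq_iff)

text \<open>Two formulas come with unrelated parameters \<open>c1\<close> and \<open>c2\<close>.
  These are interleaved into one \<open>c\<close>: \<open>r1\<close> and \<open>r2\<close> keep the
  even variables, which are shared, and send the odd ones to disjoint sets of odd variables.\<close>

lemma merge_params:
  "\<exists>r1 r2 c. inj r1 \<and> inj r2 \<and>
    (\<forall>e. (\<lambda>n. with_params c e (r1 n)) = with_params c1 e) \<and>
    (\<forall>e. (\<lambda>n. with_params c e (r2 n)) = with_params c2 e)"
proof -
  define c where "c = (\<lambda>k. if even k then c1 (k div 2) else c2 (k div 2))"
  define r1 where "r1 = (\<lambda>n::nat. if even n then n else 2 * (2 * (n div 2)) + 1)"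
  define r2 where "r2 = (\<lambda>n::nat. if even n then n else 2 * (2 * (n div 2) + 1) + 1)"
  have eq: "m = n" if "odd m" "odd n" "m div 2 = n div 2" for m n :: nat
    using that by (metis odd_two_times_div_two_succ)
  have "inj r1" "inj r2"
    by (auto simp: inj_def r1_def r2_def split: if_splits intro: eq)
  moreover have "with_params c e (r1 n) = with_params c1 e n" for e n
    by (cases "even n") (auto simp: with_params_def c_def r1_def elim: oddE)
  moreover have "with_params c e (r2 n) = with_params c2 e n" for e n
    by (simp add: with_params_def c_def r2_def)
  ultimately show ?thesis
    by (intro exI[of _ r1] exI[of _ r2] exI[of _ c]) simp
qed

section \<open>Closure properties of definable predicates\<close>

lemma definable_pred_neg:
  assumes "definable_pred M P" shows "definable_pred M (\<lambda>e. \<not> P e)"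
proof -
  obtain \<phi> c where "formula_of M \<phi>" "\<And>e. P e \<longleftrightarrow> sat M (with_params c e) \<phi>"
    using assms unfolding definable_pred_def by blast
  then show ?thesis
    unfolding definable_pred_def by (intro exI[of _ "Neg \<phi>"] exI[of _ c]) simp
qed

lemma definable_pred_conj:
  assumes "definable_pred M P" "definable_pred M Q"
  shows "definable_pred M (\<lambda>e. P e \<and> Q e)"
proof -
  obtain \<phi> c1 where \<phi>: "formula_of M \<phi>" "\<And>e. P e \<longleftrightarrow> sat M (with_params c1 e) \<phi>"
    using assms(1) unfolding definable_pred_def by blast
  obtain \<psi> c2 where \<psi>: "formula_of M \<psi>" "\<And>e. Q e \<longleftrightarrow> sat M (with_params c2 e) \<psi>"
    using assms(2) unfolding definable_pred_def by blast
  obtain r1 r2 c where "inj r1" "inj r2"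
    and r: "\<forall>e. (\<lambda>n. with_params c e (r1 n)) = with_params c1 e"
      "\<forall>e. (\<lambda>n. with_params c e (r2 n)) = with_params c2 e"
    using merge_params[of c1 c2] by (elim exE conjE)
  then show ?thesis using \<phi> \<psi> unfolding definable_pred_def
    by (intro exI[of _ "Conj (rename_form r1 \<phi>) (rename_form r2 \<psi>)"] exI[of _ c])
       (simp add: form_in_rename sat_rename)
qed

lemma definable_pred_eq:
  assumes "definable_fun M s" "definable_fun M t"
  shows "definable_pred M (\<lambda>e. s e = t e)"
proof -
  obtain a c1 where a: "term_in (fun_syms M) a" "\<And>e. s e = term_val M (with_params c1 e) a"
    using assms(1) unfolding definable_fun_def by blast
  obtain b c2 where b: "term_in (fun_syms M) b" "\<And>e. t e = term_val M (with_params c2 e) b"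
    using assms(2) unfolding definable_fun_def by blast
  obtain r1 r2 c where "inj r1" "inj r2"
    and r: "\<forall>e. (\<lambda>n. with_params c e (r1 n)) = with_params c1 e"
      "\<forall>e. (\<lambda>n. with_params c e (r2 n)) = with_params c2 e"
    using merge_params[of c1 c2] by (elim exE conjE)
  then show ?thesis using a b unfolding definable_pred_def
    by (intro exI[of _ "Eq (rename_term r1 a) (rename_term r2 b)"] exI[of _ c])
       (simp add: term_in_rename term_val_rename)
qed

lemma definable_pred_ex:
  assumes "definable_pred M P" shows "definable_pred M (\<lambda>e. \<exists>x. P (e(i := x)))"
proof -
  obtain \<phi> c where \<phi>: "formula_of M \<phi>" "\<And>e. P e \<longleftrightarrow> sat M (with_params c e) \<phi>"
    using assms unfolding definable_pred_def by blast
  have "(\<exists>x. P (e(i := x))) \<longleftrightarrow> sat M (with_params c e) (Exists (2 * i) \<phi>)" for e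
    by (simp only: \<phi>(2) sat.simps with_params_upd)
  moreover have "formula_of M (Exists (2 * i) \<phi>)" using \<phi>(1) by simp
  ultimately show ?thesis unfolding definable_pred_def by blast
qed

lemma definable_pred_disj:
  assumes "definable_pred M P" "definable_pred M Q"
  shows "definable_pred M (\<lambda>e. P e \<or> Q e)"
  using definable_pred_neg[OF definable_pred_conj[OF definable_pred_neg[OF assms(1)]
    definable_pred_neg[OF assms(2)]]] by simp

lemma definable_pred_imp:
  assumes "definable_pred M P" "definable_pred M Q"
  shows "definable_pred M (\<lambda>e. P e \<longrightarrow> Q e)"
  using definable_pred_disj[OF definable_pred_neg[OF assms(1)] assms(2)] by simp

lemma definable_pred_all:
  assumes "definable_pred M P" shows "definable_pred M (\<lambda>e. \<forall>x. P (e(i := x)))"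
  using definable_pred_neg[OF definable_pred_ex[OF definable_pred_neg[OF assms], of i]] by simp

lemma definable_fun_var: "definable_fun M (\<lambda>e. e i)"
  unfolding definable_fun_def
  by (intro exI[of _ "Var (2 * i)"]) (simp add: with_params_def)

lemma definable_fun_const: "definable_fun M (\<lambda>e. a)"
  unfolding definable_fun_def
  by (intro exI[of _ "Var 1"] exI[of _ "\<lambda>_. a"]) (simp add: with_params_def)

lemma definable_pred_const: "definable_pred M (\<lambda>e. b)"
proof -
  have "definable_pred M (\<lambda>e::nat \<Rightarrow> 'a. e 0 = e 0)"
    by (intro definable_pred_eq definable_fun_var)
  from this definable_pred_neg[OF this] show ?thesis by (cases b) simp_all
qed

lemma definable_pred_ball:
  assumes "finite I" "\<And>i. i \<in> I \<Longrightarrow> definable_pred M (P i)"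
  shows "definable_pred M (\<lambda>e. \<forall>i\<in>I. P i e)"
  using assms by (induction I rule: finite_induct) (auto intro: definable_pred_const definable_pred_conj)

lemma definable_pred_rename:
  assumes "definable_pred M P" "inj s" shows "definable_pred M (\<lambda>e. P (\<lambda>n. e (s n)))"
proof -
  obtain \<phi> c where \<phi>: "formula_of M \<phi>" "\<And>e. P e \<longleftrightarrow> sat M (with_params c e) \<phi>"
    using assms unfolding definable_pred_def by blast
  let ?r = "\<lambda>n. if even n then 2 * s (n div 2) else n"
  have "inj ?r"
  proof (rule injI)
    fix m n assume eq: "?r m = ?r n"
    then have "even m \<longleftrightarrow> even n" by (metis dvd_triv_left)
    with eq have "m div 2 = n div 2 \<or> m = n"
      using injD[OF assms(2)] by (auto split: if_splits)
    with \<open>even m \<longleftrightarrow> even n\<close> eq show "m = n"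
      by (metis dvd_mult_div_cancel)
  qed
  moreover have "(\<lambda>n. with_params c e (?r n)) = with_params c (\<lambda>n. e (s n))" for e
    by (auto simp: with_params_def fun_eq_iff)
  ultimately show ?thesis using \<phi> unfolding definable_pred_def
    by (intro exI[of _ "rename_form ?r \<phi>"] exI[of _ c]) (simp add: form_in_rename sat_rename)
qed

lemma definable_pred_fresh:
  assumes "definable_pred M P"
  obtains N where "\<And>i e x. N \<le> i \<Longrightarrow> P (e(i := x)) \<longleftrightarrow> P e"
proof -
  obtain \<phi> c where \<phi>: "\<And>e. P e \<longleftrightarrow> sat M (with_params c e) \<phi>"
    using assms unfolding definable_pred_def by blast
  obtain N where N: "\<And>n. n \<in> form_vars \<phi> \<Longrightarrow> n < N"
    using finite_form_vars[of \<phi>] finite_nat_set_iff_bounded by auto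
  have "sat M (with_params c (e(i := x))) \<phi> \<longleftrightarrow> sat M (with_params c e) \<phi>" if "N \<le> i" for i e x
    by (rule sat_cong) (use N that in \<open>fastforce simp: with_params_upd\<close>)
  then show ?thesis using that \<phi> by blast
qed

lemma definable_fun_fresh:
  assumes "definable_fun M t"
  obtains N where "\<And>i e x. N \<le> i \<Longrightarrow> t (e(i := x)) = t e"
proof -
  obtain s c where s: "\<And>e. t e = term_val M (with_params c e) s"
    using assms unfolding definable_fun_def by blast
  obtain N where N: "\<And>n. n \<in> term_vars s \<Longrightarrow> n < N"
    using finite_term_vars[of s] finite_nat_set_iff_bounded by auto
  have "term_val M (with_params c (e(i := x))) s = term_val M (with_params c e) s"
    if "N \<le> i" for i e x
    by (rule term_val_cong) (use N that in \<open>force simp: with_params_upd\<close>)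
  then show ?thesis using that s by metis
qed

text \<open>Substituting \<open>t\<close> into a formula directly could cause capture. Instead a
  fresh variable \<open>k\<close> receives the value of \<open>t\<close>, and \<open>i\<close> reads
  it from there.\<close>

lemma definable_pred_subst:
  assumes P: "definable_pred M P" and t: "definable_fun M t"
  shows "definable_pred M (\<lambda>e. P (e(i := t e)))"
proof -
  obtain N where N: "\<And>i e x. N \<le> i \<Longrightarrow> P (e(i := x)) \<longleftrightarrow> P e"
    using definable_pred_fresh[OF P] by blast
  obtain N' where N': "\<And>i e x. N' \<le> i \<Longrightarrow> t (e(i := x)) = t e"
    using definable_fun_fresh[OF t] by blast
  define k where "k = N + N' + i + 1"
  have k: "N \<le> k" "N' \<le> k" "k \<noteq> i" by (simp_all add: k_def)
  define s where "s = id(i := k, k := i)"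
  have "inj s" by (auto simp: s_def inj_def)
  have "P (\<lambda>n. e (s n)) \<longleftrightarrow> P (e(i := e k))" for e
  proof -
    have "(\<lambda>n. e (s n)) = (e(i := e k))(k := e i)"
      using k(3) by (auto simp: s_def fun_eq_iff)
    then show ?thesis by (simp only: N[OF k(1)])
  qed
  then have "definable_pred M (\<lambda>e. P (e(i := e k)))"
    using definable_pred_rename[OF P \<open>inj s\<close>] by simp
  then have "definable_pred M (\<lambda>e. e k = t e \<and> P (e(i := e k)))"
    by (intro definable_pred_conj definable_pred_eq definable_fun_var t)
  from definable_pred_ex[OF this, of k]
  have *: "definable_pred M (\<lambda>e. \<exists>z. z = t e \<and> P (e(k := z, i := z)))"
    by (simp only: N'[OF k(2)] fun_upd_same)
  have "P (e(k := z, i := z)) \<longleftrightarrow> P (e(i := z))" for e z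
    unfolding fun_upd_twist[OF k(3)] by (rule N[OF k(1)])
  with * show ?thesis by simp
qed

text \<open>This returns to definability of sets, where the distinguished variable is 0: the
  renaming moves variable \<open>2 * i\<close> there and shifts the others up by one, so that their
  values under \<open>?e\<close> serve as parameters.\<close>

lemma definable_set_slice:
  assumes "definable_pred M P" shows "definable_set M {x. P (e(i := x))}"
proof -
  obtain \<phi> c where \<phi>: "formula_of M \<phi>" "\<And>e. P e \<longleftrightarrow> sat M (with_params c e) \<phi>"
    using assms unfolding definable_pred_def by blast
  let ?r = "\<lambda>n. if n = 2 * i then 0 else Suc n"
  let ?e = "\<lambda>n. with_params c e (n - 1)"
  have "inj ?r" by (auto simp: inj_def split: if_splits)
  moreover have "(\<lambda>n. (?e(0 := x)) (?r n)) = with_params c (e(i := x))" for x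
    by (auto simp: with_params_upd fun_eq_iff)
  ultimately show ?thesis using \<phi> unfolding definable_set_def
    by (intro exI[of _ "rename_form ?r \<phi>"] exI[of _ ?e])
       (simp add: form_in_rename sat_rename del: fun_upd_apply)
qed

lemma definable_rel_slice:
  assumes "definable_pred M P" "i \<noteq> j"
  shows "definable_rel M {(x, y). P (e(i := x, j := y))}"
proof -
  obtain \<phi> c where \<phi>: "formula_of M \<phi>" "\<And>e. P e \<longleftrightarrow> sat M (with_params c e) \<phi>"
    using assms unfolding definable_pred_def by blast
  let ?r = "\<lambda>n. if n = 2 * i then 0 else if n = 2 * j then 1 else n + 2"
  let ?e = "\<lambda>n. with_params c e (n - 2)"
  have "inj ?r" by (auto simp: inj_def split: if_splits)
  moreover have "(\<lambda>n. (?e(0 := x, 1 := y)) (?r n)) = with_params c (e(i := x, j := y))" for x y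
    using assms(2) by (auto simp: with_params_upd fun_eq_iff)
  ultimately show ?thesis using \<phi> unfolding definable_rel_def
    by (intro exI[of _ "rename_form ?r \<phi>"] exI[of _ ?e])
       (simp add: form_in_rename sat_rename del: fun_upd_apply)
qed

section \<open>Definability and commutation of almost all\<close>

locale minimal_unordered_field =
  fixes M :: "('a::field, 'f, 'r) fo_structure"
  assumes minimal: "minimal_field M"
    and unordered: "\<not> ordered_structure M"
begin

lemma infinite_univ: "infinite (UNIV :: 'a set)"
  using minimal by (auto simp: minimal_field_def minimal_structure_def)

lemma cofinite_neq_bot: "(cofinite :: 'a filter) \<noteq> bot"
  using infinite_univ by (simp add: cofinite_bot)

lemma finite_or_cofinite:
  assumes "definable_pred M P"
  shows "finite {x. P (e(i := x))} \<or> finite {x. \<not> P (e(i := x))}"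
  using definable_set_slice[OF assms, of e i] minimal
  by (auto simp: minimal_field_def minimal_structure_def Compl_eq)

text \<open>By minimality the cofinite filter acts as an ultrafilter on definable subsets of the
  field, so negation passes through the quantifier.\<close>

lemma not_almost_all_iff:
  assumes "definable_pred M P"
  shows "\<not> (\<forall>\<^sub>F x in cofinite. P (e(i := x))) \<longleftrightarrow> (\<forall>\<^sub>F x in cofinite. \<not> P (e(i := x)))"
proof
  assume "\<not> (\<forall>\<^sub>F x in cofinite. P (e(i := x)))"
  then show "\<forall>\<^sub>F x in cofinite. \<not> P (e(i := x))"
    using finite_or_cofinite[OF assms, of e i] by (simp add: eventually_cofinite)
next
  assume "\<forall>\<^sub>F x in cofinite. \<not> P (e(i := x))"
  moreover have "\<not> (\<forall>\<^sub>F x in cofinite. P (e(i := x)) \<and> \<not> P (e(i := x)))"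
    using cofinite_neq_bot by (simp add: eventually_False)
  ultimately show "\<not> (\<forall>\<^sub>F x in cofinite. P (e(i := x)))"
    using eventually_conj by blast
qed

section \<open>Field operations as definable functions\<close>

lemma definable_fun_binop:
  assumes "(f, 2) \<in> fun_syms M" "definable_fun M s" "definable_fun M t"
  shows "definable_fun M (\<lambda>e. fun_interp M f [s e, t e])"
proof -
  obtain a c1 where a: "term_in (fun_syms M) a" "\<And>e. s e = term_val M (with_params c1 e) a"
    using assms(2) unfolding definable_fun_def by blast
  obtain b c2 where b: "term_in (fun_syms M) b" "\<And>e. t e = term_val M (with_params c2 e) b"
    using assms(3) unfolding definable_fun_def by blast
  obtain r1 r2 c where
    r: "\<forall>e. (\<lambda>n. with_params c e (r1 n)) = with_params c1 e"
      "\<forall>e. (\<lambda>n. with_params c e (r2 n)) = with_params c2 e"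
    using merge_params[of c1 c2] by (elim exE conjE)
  then show ?thesis using a b assms(1) unfolding definable_fun_def
    by (intro exI[of _ "Fun f [rename_term r1 a, rename_term r2 b]"] exI[of _ c])
       (simp add: term_in_rename term_val_rename numeral_2_eq_2)
qed

lemma definable_fun_add:
  assumes "definable_fun M s" "definable_fun M t" shows "definable_fun M (\<lambda>e. s e + t e)"
proof -
  obtain p where p: "(p, 2) \<in> fun_syms M" "\<And>x y. fun_interp M p [x, y] = x + y"
    using minimal by (auto simp: minimal_field_def field_structure_def)
  show ?thesis using definable_fun_binop[OF p(1) assms] by (simp only: p(2))
qed

lemma definable_fun_mult:
  assumes "definable_fun M s" "definable_fun M t" shows "definable_fun M (\<lambda>e. s e * t e)"
proof -
  obtain p where p: "(p, 2) \<in> fun_syms M" "\<And>x y. fun_interp M p [x, y] = x * y"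
    using minimal by (auto simp: minimal_field_def field_structure_def)
  show ?thesis using definable_fun_binop[OF p(1) assms] by (simp only: p(2))
qed

lemma definable_fun_sum:
  assumes "\<And>i. i \<in> I \<Longrightarrow> definable_fun M (t i)"
  shows "definable_fun M (\<lambda>e. \<Sum>i\<in>I. t i e)"
  using assms
  by (induction I rule: infinite_finite_induct) (auto intro: definable_fun_const definable_fun_add)

lemma definable_fun_power:
  assumes "definable_fun M t" shows "definable_fun M (\<lambda>e. t e ^ n)"
  using assms by (induction n) (auto intro: definable_fun_const definable_fun_mult)

section \<open>Definability of the quantifier almost all\<close>

lemma cofinite_iff_translate:
  assumes "finite H \<or> finite (- H)"
  shows "finite (- H) \<longleftrightarrow> (\<exists>c::'a. \<forall>x. x \<in> H \<or> x + c \<in> H)"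
proof
  assume fin: "finite (- H)"
  \<comment> \<open>If neither \<open>x\<close> nor \<open>x + c\<close> lies in \<open>H\<close>,
    then \<open>c\<close> is a difference of two elements outside \<open>H\<close>. Only finitely
    many \<open>c\<close> are excluded in this way.\<close>
  have "finite ((\<lambda>(x, y). y - x) ` ((- H) \<times> (- H)))" using fin by simp
  then obtain c where "c \<notin> (\<lambda>(x, y). y - x) ` ((- H) \<times> (- H))"
    using ex_new_if_finite[OF infinite_univ] by blast
  then have "x \<in> H \<or> x + c \<in> H" for x
    by (force simp: image_iff)
  then show "\<exists>c. \<forall>x. x \<in> H \<or> x + c \<in> H" by blast
next
  assume "\<exists>c. \<forall>x. x \<in> H \<or> x + c \<in> H"
  then obtain c where c: "\<And>x. x \<in> H \<or> x + c \<in> H" by blast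
  have "UNIV \<subseteq> H \<union> (\<lambda>x. x - c) ` H"
  proof
    fix x show "x \<in> H \<union> (\<lambda>x. x - c) ` H"
      using c[of x] by (auto simp: image_iff intro: bexI[of _ "x + c"])
  qed
  then have "infinite H" using infinite_univ finite_subset by blast
  with assms show "finite (- H)" by blast
qed

lemma definable_pred_almost_all:
  assumes "definable_pred M P"
  shows "definable_pred M (\<lambda>e. \<forall>\<^sub>F x in cofinite. P (e(i := x)))"
proof -
  obtain N where N: "\<And>i e x. N \<le> i \<Longrightarrow> P (e(i := x)) \<longleftrightarrow> P e"
    using definable_pred_fresh[OF assms] by blast
  \<comment> \<open>The translation is kept in a fresh variable \<open>j\<close>, so that
    quantifying over it does not disturb \<open>P\<close>.\<close>
  define j where "j = N + i + 1"
  have j: "N \<le> j" "j \<noteq> i" by (simp_all add: j_def)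
  have "definable_pred M (\<lambda>e. P e \<or> P (e(i := e i + e j)))"
    by (intro definable_pred_disj definable_pred_subst assms definable_fun_add definable_fun_var)
  from definable_pred_ex[OF definable_pred_all[OF this, of i], of j]
  have *: "definable_pred M (\<lambda>e. \<exists>c. \<forall>x. P (e(j := c, i := x)) \<or> P (e(j := c, i := x + c)))"
    using j(2) by simp
  have "P (e(j := c, i := x)) \<longleftrightarrow> P (e(i := x))" for e c x
    unfolding fun_upd_twist[OF j(2)] by (rule N[OF j(1)])
  moreover have "(\<forall>\<^sub>F x in cofinite. P (e(i := x))) \<longleftrightarrow>
      (\<exists>c. \<forall>x. P (e(i := x)) \<or> P (e(i := x + c)))" for e
    using cofinite_iff_translate[of "{x. P (e(i := x))}"] finite_or_cofinite[OF assms, of e i]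
    by (simp add: eventually_cofinite Compl_eq)
  ultimately show ?thesis using * by simp
qed

section \<open>Unorderedness and commutation of almost all\<close>

lemma definable_order_trivial:
  assumes "definable_rel M R" "irrefl R" "trans R"
  obtains A where "finite A" "\<And>x y. x \<notin> A \<Longrightarrow> y \<notin> A \<Longrightarrow> (x, y) \<notin> R"
proof -
  have "definable_rel (equality_reduct M) R"
    using assms unordered by (auto simp: ordered_structure_def)
  then obtain A where A: "finite A"
      "\<And>x y. x \<notin> A \<Longrightarrow> y \<notin> A \<Longrightarrow> (x, y) \<in> R \<Longrightarrow> (y, x) \<in> R"
    by (rule equality_definable_symmetric) blast
  have "(x, y) \<notin> R" if "x \<notin> A" "y \<notin> A" for x y
    using A(2)[OF that] assms(2,3) by (meson irrefl_def transD)
  with A(1) show ?thesis by (rule that)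
qed

text \<open>Strict inclusion compares the sets at two values of the same variable \<open>j\<close>.
  The second value is stored in a fresh variable \<open>k\<close>, and \<open>?Q\<close> is
  \<open>P\<close> read at that value.\<close>

lemma definable_rel_psubset:
  assumes "definable_pred M P" "i \<noteq> j"
  shows "definable_rel M {(y, y').
    {x. P (e(i := x, j := y))} \<subset> {x. P (e(i := x, j := y'))}}"
proof -
  obtain N where N: "\<And>i e x. N \<le> i \<Longrightarrow> P (e(i := x)) \<longleftrightarrow> P e"
    using definable_pred_fresh[OF assms(1)] by blast
  define k where "k = N + i + j + 1"
  have k: "N \<le> k" "k \<noteq> i" "k \<noteq> j" by (simp_all add: k_def)
  let ?Q = "\<lambda>e. P (e(j := e k))"
  have Q: "definable_pred M ?Q"
    by (intro definable_pred_subst assms definable_fun_var)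
  have R: "definable_pred M (\<lambda>e. (\<forall>x. P (e(i := x)) \<longrightarrow> ?Q (e(i := x))) \<and>
      (\<exists>x. ?Q (e(i := x)) \<and> \<not> P (e(i := x))))"
    by (intro definable_pred_conj
      definable_pred_all[of M "\<lambda>e. P e \<longrightarrow> ?Q e"] definable_pred_ex[of M "\<lambda>e. ?Q e \<and> \<not> P e"]
      definable_pred_imp definable_pred_neg Q assms(1))
  have "P (e(j := y, k := y', i := x)) \<longleftrightarrow> P (e(i := x, j := y))" for x y y'
  proof -
    have "e(j := y, k := y', i := x) = e(i := x, j := y, k := y')"
      using k assms(2) by (auto simp: fun_eq_iff)
    then show ?thesis by (simp only: N[OF k(1)])
  qed
  moreover have "?Q (e(j := y, k := y', i := x)) \<longleftrightarrow> P (e(i := x, j := y'))" for x y y'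
  proof -
    have "(e(j := y, k := y', i := x))(j := y') = e(i := x, j := y', k := y')"
      using k assms(2) by (auto simp: fun_eq_iff)
    moreover have "(e(j := y, k := y', i := x)) k = y'" using k(2) by simp
    ultimately show ?thesis by (simp only: N[OF k(1)])
  qed
  ultimately have "{(y, y'). {x. P (e(i := x, j := y))} \<subset> {x. P (e(i := x, j := y'))}} =
      {(y, y'). (\<forall>x. P (e(j := y, k := y', i := x)) \<longrightarrow> ?Q (e(j := y, k := y', i := x))) \<and>
        (\<exists>x. ?Q (e(j := y, k := y', i := x)) \<and> \<not> P (e(j := y, k := y', i := x)))}"
    by (simp only:) blast
  also have "definable_rel M \<dots>"
    by (rule definable_rel_slice[OF R k(3)[symmetric]])
  finally show ?thesis .
qed

text \<open>
  If the two iterated quantifiers disagreed, the sets \<open>{x. P x y}\<close>, cut down to those \<open>x\<close> for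
  which almost all \<open>y\<close> satisfy \<open>P x y\<close>, would be finite for almost all \<open>y\<close>, and each of them
  would be properly contained in almost all others: a nontrivial definable order.
\<close>

lemma almost_all_commute:
  assumes P: "definable_pred M P" and ij: "i \<noteq> j"
    and PP: "\<forall>\<^sub>F x in cofinite. \<forall>\<^sub>F y in cofinite. P (e(i := x, j := y))"
  shows "\<forall>\<^sub>F y in cofinite. \<forall>\<^sub>F x in cofinite. P (e(j := y, i := x))"
proof (rule ccontr)
  assume "\<not> ?thesis"
  then have "\<forall>\<^sub>F y in cofinite. \<not> (\<forall>\<^sub>F x in cofinite. P (e(j := y, i := x)))"
    by (subst (asm) not_almost_all_iff[OF definable_pred_almost_all[OF P]])
  then have fin: "\<forall>\<^sub>F y in cofinite. finite {x. P (e(i := x, j := y))}"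
    unfolding not_almost_all_iff[OF P] fun_upd_twist[OF ij]
    by (simp add: eventually_cofinite)
  \<comment> \<open>Requiring \<open>D\<close> inside the predicate makes strict inclusion between
    the sets \<open>S y\<close> definable.\<close>
  define P' where "P' = (\<lambda>e. P e \<and> (\<forall>\<^sub>F y in cofinite. P (e(j := y))))"
  have P': "definable_pred M P'"
    unfolding P'_def by (intro definable_pred_conj P definable_pred_almost_all)
  define D where "D x \<longleftrightarrow> (\<forall>\<^sub>F y in cofinite. P (e(i := x, j := y)))" for x
  define S where "S y = {x. P (e(i := x, j := y)) \<and> D x}" for y
  have S_eq: "S y = {x. P' (e(i := x, j := y))}" for y
    by (simp add: S_def P'_def D_def)
  have "definable_rel M {(y, y'). S y \<subset> S y'}"
    unfolding S_eq by (rule definable_rel_psubset[OF P' ij])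
  moreover have "irrefl {(y, y'). S y \<subset> S y'}" "trans {(y, y'). S y \<subset> S y'}"
    by (auto simp: irrefl_def trans_def)
  ultimately obtain A where A: "finite A"
    "\<And>y y'. y \<notin> A \<Longrightarrow> y' \<notin> A \<Longrightarrow> (y, y') \<notin> {(y, y'). S y \<subset> S y'}"
    by (rule definable_order_trivial) blast
  have notA: "\<forall>\<^sub>F y in cofinite. y \<notin> A" using A(1) by (simp add: eventually_cofinite)
  obtain y where y: "finite {x. P (e(i := x, j := y))}" "y \<notin> A"
    using eventually_happens[OF eventually_conj[OF fin notA]] cofinite_neq_bot by blast
  have "finite (S y)" by (rule finite_subset[OF _ y(1)]) (auto simp: S_def)
  then have "\<forall>\<^sub>F x in cofinite. x \<notin> S y" by (simp add: eventually_cofinite)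
  with PP have "\<forall>\<^sub>F x in cofinite. x \<notin> S y \<and> D x"
    unfolding D_def by eventually_elim simp
  \<comment> \<open>Adding \<open>z\<close> to the finite set \<open>S y\<close> gives a finite set
    of elements satisfying \<open>D\<close>. Almost every \<open>y'\<close> meets all their
    conditions at once, and then \<open>S y\<close> is strictly contained in
    \<open>S y'\<close>.\<close>
  then obtain z where z: "z \<notin> S y" "D z"
    using eventually_happens cofinite_neq_bot by blast
  have "\<forall>\<^sub>F y' in cofinite. \<forall>x\<in>insert z (S y). P (e(i := x, j := y'))"
    by (rule eventually_ball_finite) (use z \<open>finite (S y)\<close> in \<open>auto simp: S_def D_def\<close>)
  with notA have "\<forall>\<^sub>F y' in cofinite. y' \<notin> A \<and> insert z (S y) \<subseteq> S y'"
  proof eventually_elim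
    case (elim y')
    then show ?case using z by (auto simp: S_def)
  qed
  then obtain y' where "y' \<notin> A" "insert z (S y) \<subseteq> S y'"
    using eventually_happens cofinite_neq_bot by blast
  with A(2)[OF y(2), of y'] z(1) show False by blast
qed

end

section \<open>Dimension\<close>

primrec almost_all :: "nat list \<Rightarrow> ((nat \<Rightarrow> 'a) \<Rightarrow> bool) \<Rightarrow> (nat \<Rightarrow> 'a) \<Rightarrow> bool" where
  "almost_all [] P e = P e"
| "almost_all (i # is) P e = (\<forall>\<^sub>F x in cofinite. almost_all is P (e(i := x)))"

primrec exists_on :: "nat list \<Rightarrow> ((nat \<Rightarrow> 'a) \<Rightarrow> bool) \<Rightarrow> (nat \<Rightarrow> 'a) \<Rightarrow> bool" where
  "exists_on [] P e = P e"
| "exists_on (i # is) P e = (\<exists>x. exists_on is P (e(i := x)))"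

lemma exists_on_iff:
  "exists_on is P e \<longleftrightarrow> (\<exists>e'. (\<forall>j. j \<notin> set is \<longrightarrow> e' j = e j) \<and> P e')"
proof (induction "is" arbitrary: e)
  case Nil
  have "e' = e" if "\<forall>j. j \<notin> set [] \<longrightarrow> e' j = e j" for e' :: "nat \<Rightarrow> 'a"
    using that by auto
  then show ?case by auto
next
  case (Cons i "is")
  show ?case
  proof
    assume "exists_on (i # is) P e"
    then obtain x e' where "\<forall>j. j \<notin> set is \<longrightarrow> e' j = (e(i := x)) j" "P e'"
      using Cons.IH by auto
    then show "\<exists>e'. (\<forall>j. j \<notin> set (i # is) \<longrightarrow> e' j = e j) \<and> P e'"
      by (intro exI[of _ e']) auto
  next
    assume "\<exists>e'. (\<forall>j. j \<notin> set (i # is) \<longrightarrow> e' j = e j) \<and> P e'"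
    then obtain e' where "\<forall>j. j \<notin> set (i # is) \<longrightarrow> e' j = e j" "P e'"
      by blast
    then have "exists_on is P (e(i := e' i))"
      unfolding Cons.IH by (intro exI[of _ e']) auto
    then show "exists_on (i # is) P e" by auto
  qed
qed

lemma almost_all_mono:
  assumes "almost_all is P e" "\<And>e. P e \<Longrightarrow> Q e" shows "almost_all is Q e"
  using assms(1)
proof (induction "is" arbitrary: e)
  case (Cons i "is")
  show ?case using Cons.prems
    by (auto elim!: eventually_mono intro: Cons.IH)
qed (use assms(2) in auto)

context minimal_unordered_field
begin

lemma definable_pred_almost_all_list:
  assumes "definable_pred M P" shows "definable_pred M (almost_all is P)"
proof (induction "is")
  case Nil
  have "almost_all [] P = P" by (simp add: fun_eq_iff)
  then show ?case using assms by simp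
next
  case (Cons i "is")
  have "almost_all (i # is) P = (\<lambda>e. \<forall>\<^sub>F x in cofinite. almost_all is P (e(i := x)))"
    by (simp add: fun_eq_iff)
  then show ?case by (simp only: definable_pred_almost_all[OF Cons])
qed

lemma definable_pred_exists_on:
  assumes "definable_pred M P" shows "definable_pred M (exists_on is P)"
proof (induction "is")
  case Nil
  have "exists_on [] P = P" by (simp add: fun_eq_iff)
  then show ?case using assms by simp
next
  case (Cons i "is")
  have "exists_on (i # is) P = (\<lambda>e. \<exists>x. exists_on is P (e(i := x)))"
    by (simp add: fun_eq_iff)
  then show ?case by (simp only: definable_pred_ex[OF Cons])
qed

lemma almost_all_exI:
  assumes "i \<notin> set is" "almost_all is P (e(i := x))"
  shows "almost_all is (\<lambda>e. \<exists>x. P (e(i := x))) e"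
  using assms
proof (induction "is" arbitrary: e)
  case Nil
  then show ?case by auto
next
  case (Cons j "is")
  have "i \<noteq> j" using Cons.prems(1) by simp
  have "\<forall>\<^sub>F y in cofinite. almost_all is P (e(j := y, i := x))"
    using Cons.prems(2) by (simp only: almost_all.simps fun_upd_twist[OF \<open>i \<noteq> j\<close>])
  then show ?case unfolding almost_all.simps
  proof eventually_elim
    case (elim y)
    show ?case by (rule Cons.IH[OF _ elim]) (use Cons.prems(1) in simp)
  qed
qed

lemma almost_all_not_in:
  assumes "i \<in> set is" "distinct is" shows "almost_all is (\<lambda>e. e i \<noteq> a) e"
  using assms
proof (induction "is" arbitrary: e)
  case (Cons j "is" e)
  \<comment> \<open>Once \<open>i\<close> has received a value other than \<open>a\<close>, the
    later variables, all different from \<open>i\<close>, leave it unchanged.\<close>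
  have skip: "almost_all js (\<lambda>e. e i \<noteq> a) e'" if "i \<notin> set js" "e' i \<noteq> a" for js e'
    using that
  proof (induction js arbitrary: e')
    case (Cons k js e')
    have "almost_all js (\<lambda>e. e i \<noteq> a) (e'(k := x))" for x
      by (rule Cons.IH) (use Cons.prems in auto)
    then show ?case unfolding almost_all.simps by (intro always_eventually allI)
  qed simp
  have "almost_all is (\<lambda>e. e i \<noteq> a) (e(j := x))" if "x \<noteq> a" for x
  proof (cases "i = j")
    case True
    show ?thesis by (rule skip) (use True Cons.prems that in auto)
  next
    case False
    show ?thesis by (rule Cons.IH) (use False Cons.prems in auto)
  qed
  moreover have "\<forall>\<^sub>F x in cofinite. x \<noteq> a" by (simp add: eventually_cofinite)
  ultimately show ?case unfolding almost_all.simps by (rule eventually_mono[rotated])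
qed simp

text \<open>The exchange principle of the dimension theory: a witness variable can either be fixed
  once and for all, or become generic in place of a coordinate, which then turns into a witness
  variable itself.\<close>

lemma almost_all_ex_cases:
  assumes P: "definable_pred M P" and "distinct bs" "c \<notin> set bs"
    and "almost_all bs (\<lambda>e. \<exists>y. P (e(c := y))) e"
  shows "(\<exists>y. almost_all bs P (e(c := y))) \<or>
    (\<exists>i\<in>set bs. \<forall>\<^sub>F y in cofinite.
      almost_all (remove1 i bs) (\<lambda>e. \<exists>x. P (e(i := x))) (e(c := y)))"
  using assms(2-4)
proof (induction bs arbitrary: e)
  case Nil
  then show ?case by simp
next
  case (Cons i bs)
  have ic: "i \<noteq> c" and i: "i \<notin> set bs" using Cons.prems by auto
  let ?T = "almost_all bs P"
  have T: "definable_pred M ?T" by (rule definable_pred_almost_all_list[OF P])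
  define A where "A e \<longleftrightarrow> (\<exists>y. ?T (e(c := y)))" for e
  have A: "definable_pred M A"
    unfolding A_def[abs_def] by (rule definable_pred_ex[OF T])
  define X where "X j = almost_all (remove1 j bs) (\<lambda>e. \<exists>x. P (e(j := x)))" for j
  have X: "definable_pred M (X j)" for j
    unfolding X_def by (intro definable_pred_almost_all_list definable_pred_ex P)
  define B where "B j e \<longleftrightarrow> (\<forall>\<^sub>F y in cofinite. X j (e(c := y)))" for j e
  have B: "definable_pred M (B j)" for j
    unfolding B_def[abs_def] by (rule definable_pred_almost_all[OF X])
  have "\<forall>\<^sub>F x in cofinite. A (e(i := x)) \<or> (\<exists>j\<in>set bs. B j (e(i := x)))"
    using Cons.prems(3) unfolding almost_all.simps
  proof eventually_elim
    case (elim x)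
    then show ?case
      using Cons.IH[of "e(i := x)"] Cons.prems(1,2) unfolding A_def B_def X_def
      by (simp del: fun_upd_apply)
  qed
  \<comment> \<open>There are finitely many definable alternatives, the same for all
    \<open>x\<close>. If each failed for almost all \<open>x\<close>, some \<open>x\<close> would
    refute them all; hence one of them holds for almost all \<open>x\<close>.\<close>
  then consider "\<forall>\<^sub>F x in cofinite. A (e(i := x))"
    | j where "j \<in> set bs" "\<forall>\<^sub>F x in cofinite. B j (e(i := x))"
  proof (rule contrapos_pp)
    assume "\<not> thesis"
    then have "\<not> (\<forall>\<^sub>F x in cofinite. A (e(i := x)))"
      "\<And>j. j \<in> set bs \<Longrightarrow> \<not> (\<forall>\<^sub>F x in cofinite. B j (e(i := x)))"
      using that by blast+
    then have "\<forall>\<^sub>F x in cofinite. \<not> A (e(i := x))"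
      "\<forall>\<^sub>F x in cofinite. \<forall>j\<in>set bs. \<not> B j (e(i := x))"
      unfolding not_almost_all_iff[OF A] not_almost_all_iff[OF B]
      by (auto intro: eventually_ball_finite)
    then have "\<forall>\<^sub>F x in cofinite. \<not> (A (e(i := x)) \<or> (\<exists>j\<in>set bs. B j (e(i := x))))"
      by eventually_elim blast
    then show "\<not> (\<forall>\<^sub>F x in cofinite. A (e(i := x)) \<or> (\<exists>j\<in>set bs. B j (e(i := x))))"
      using eventually_conj cofinite_neq_bot eventually_happens by fastforce
  qed
  then show ?case
  proof cases
    case 1
    show ?thesis
    proof (cases "\<exists>y. \<forall>\<^sub>F x in cofinite. ?T (e(c := y, i := x))")
      case True
      then show ?thesis unfolding almost_all.simps by blast
    next
      case False
      then have fin: "finite {x. ?T (e(c := y, i := x))}" for y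
        using not_almost_all_iff[OF T, of "e(c := y)" i] by (simp add: eventually_cofinite)
      \<comment> \<open>Each \<open>y\<close> now serves only finitely many \<open>x\<close>, while
        infinitely many \<open>x\<close> are served. So infinitely many \<open>y\<close> occur,
        hence almost all, and \<open>c\<close> takes the place of \<open>i\<close>.\<close>
      define Y where "Y = {y. \<exists>x. ?T (e(c := y, i := x))}"
      have "{x. A (e(i := x))} \<subseteq> (\<Union>y\<in>Y. {x. ?T (e(c := y, i := x))})"
        using ic unfolding A_def Y_def by (auto simp: fun_upd_twist)
      moreover have "infinite {x. A (e(i := x))}"
      proof
        assume "finite {x. A (e(i := x))}"
        then have "finite ({x. A (e(i := x))} \<union> {x. \<not> A (e(i := x))})"
          using 1 by (simp add: eventually_cofinite)
        moreover have "{x. A (e(i := x))} \<union> {x. \<not> A (e(i := x))} = UNIV" by blast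
        ultimately show False using infinite_univ by simp
      qed
      ultimately have "infinite Y" using fin finite_subset finite_UN_I by metis
      then have "\<forall>\<^sub>F y in cofinite. \<exists>x. ?T (e(c := y, i := x))"
        using finite_or_cofinite[OF definable_pred_ex[OF T, of i], of e c]
        by (simp add: Y_def eventually_cofinite)
      then have "\<forall>\<^sub>F y in cofinite. almost_all bs (\<lambda>e. \<exists>x. P (e(i := x))) (e(c := y))"
        by (auto elim!: eventually_mono intro: almost_all_exI[OF i])
      then show ?thesis by (intro disjI2 bexI[of _ i]) (auto simp del: fun_upd_apply)
    qed
  next
    case (2 j)
    have "j \<noteq> i" using 2(1) i by blast
    have "\<forall>\<^sub>F y in cofinite. \<forall>\<^sub>F x in cofinite. X j (e(c := y, i := x))"
      \<comment> \<open>The generic values at \<open>i\<close> and at \<open>c\<close> must change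
        places; this is where the absence of definable orders enters.\<close>
      using almost_all_commute[OF X ic] 2(2) unfolding B_def by blast
    then show ?thesis using \<open>j \<noteq> i\<close> 2(1)
      by (intro disjI2 bexI[of _ j]) (auto simp: X_def simp del: fun_upd_apply)
  qed
qed

text \<open>Induction on \<open>cs\<close>. By exchange, its first variable is either fixed at one
  value or replaces an element of \<open>bs\<close>, which then leaves \<open>bs\<close>; either way
  \<open>length cs < length bs\<close> survives. In the end a nonempty \<open>bs\<close> remains,
  and its first coordinate would take almost all values within one fibre. Finiteness of fibres is
  expressed coordinate by coordinate.\<close>

lemma no_finite_fibres:
  assumes "definable_pred M P" "distinct bs" "set bs \<inter> set cs = {}" "length cs < length bs"
    and "\<And>e i. i \<in> set bs \<Longrightarrow> finite {e' i |e'. (\<forall>j. j \<notin> set bs \<longrightarrow> e' j = e j) \<and> P e'}"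
  shows "\<not> almost_all bs (exists_on cs P) e"
  using assms
proof (induction cs arbitrary: bs P e)
  case Nil
  obtain i "is" where bs: "bs = i # is" using Nil.prems(4) by (cases bs) auto
  have witness: "\<exists>e'. (\<forall>j. j \<notin> set js \<longrightarrow> e' j = e j) \<and> P e'" if "almost_all js P e" for js e
    using that
  proof (induction js arbitrary: e)
    case (Cons j js)
    then obtain x where "almost_all js P (e(j := x))"
      using eventually_happens cofinite_neq_bot by fastforce
    from Cons.IH[OF this] obtain e' where
      "\<forall>k. k \<notin> set js \<longrightarrow> e' k = (e(j := x)) k" "P e'" by blast
    then show ?case by (intro exI[of _ e']) auto
  qed auto
  show ?case
  proof
    assume "almost_all bs (exists_on [] P) e"
    then have "almost_all bs P e" by (rule almost_all_mono) simp
    then have "finite {x. \<not> almost_all is P (e(i := x))}"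
      by (simp add: bs eventually_cofinite)
    moreover have "{x. almost_all is P (e(i := x))} \<subseteq>
        {e' i |e'. (\<forall>j. j \<notin> set bs \<longrightarrow> e' j = e j) \<and> P e'}"
    proof clarify
      fix x assume "almost_all is P (e(i := x))"
      from witness[OF this] obtain e' where
        e': "\<forall>j. j \<notin> set is \<longrightarrow> e' j = (e(i := x)) j" "P e'" by blast
      have "e' i = x" using e'(1) Nil.prems(2) by (simp add: bs)
      then show "\<exists>e'. x = e' i \<and> (\<forall>j. j \<notin> set bs \<longrightarrow> e' j = e j) \<and> P e'"
        using e' by (intro exI[of _ e']) (auto simp: bs)
    qed
    then have "finite {x. almost_all is P (e(i := x))}"
      by (rule finite_subset) (rule Nil.prems(5), simp add: bs)
    moreover have "{x. almost_all is P (e(i := x))} \<union> {x. \<not> almost_all is P (e(i := x))} = UNIV"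
      by blast
    ultimately show False using infinite_univ by (metis finite_Un)
  qed
next
  case (Cons c cs)
  show ?case
  proof
    assume "almost_all bs (exists_on (c # cs) P) e"
    then have "almost_all bs (\<lambda>e. \<exists>y. exists_on cs P (e(c := y))) e"
      by (rule almost_all_mono) simp
    then consider y where "almost_all bs (exists_on cs P) (e(c := y))"
      | i y where "i \<in> set bs"
          "almost_all (remove1 i bs) (\<lambda>e. \<exists>x. exists_on cs P (e(i := x))) (e(c := y))"
      using almost_all_ex_cases[OF definable_pred_exists_on[OF Cons.prems(1), of cs]
          Cons.prems(2), of c e] Cons.prems(3) eventually_happens cofinite_neq_bot by fastforce
    then show False
    proof cases
      case 1
      have "\<not> almost_all bs (exists_on cs P) (e(c := y))"
        by (rule Cons.IH[OF Cons.prems(1,2)]) (use Cons.prems(3,4,5) in auto)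
      with 1 show False by blast
    next
      case (2 i y)
      have "exists_on cs (\<lambda>e. \<exists>x. P (e(i := x))) e" if ex: "\<exists>x. exists_on cs P (e(i := x))" for e
      proof -
        obtain x where "exists_on cs P (e(i := x))" using ex by blast
        then obtain e' where e': "\<forall>j. j \<notin> set cs \<longrightarrow> e' j = (e(i := x)) j" "P e'"
          using exists_on_iff[of cs P "e(i := x)"] by blast
        \<comment> \<open>The quantifier over \<open>i\<close> moves inside those over
          \<open>cs\<close>: coordinate \<open>i\<close> is put back to \<open>e i\<close>, and the
          inner quantifier supplies \<open>e' i\<close>.\<close>
        have "P ((e'(i := e i))(i := e' i))" using e'(2) by simp
        moreover have "\<forall>j. j \<notin> set cs \<longrightarrow> (e'(i := e i)) j = e j" using e'(1) by simp
        ultimately show ?thesis unfolding exists_on_iff by blast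
      qed
      then have "almost_all (remove1 i bs) (exists_on cs (\<lambda>e. \<exists>x. P (e(i := x)))) (e(c := y))"
        by (rule almost_all_mono[OF 2(2)])
      moreover have "\<not> almost_all (remove1 i bs) (exists_on cs (\<lambda>e. \<exists>x. P (e(i := x)))) (e(c := y))"
      proof (rule Cons.IH)
        show "definable_pred M (\<lambda>e. \<exists>x. P (e(i := x)))"
          by (rule definable_pred_ex[OF Cons.prems(1)])
        show "distinct (remove1 i bs)" "set (remove1 i bs) \<inter> set cs = {}"
          "length cs < length (remove1 i bs)"
          using Cons.prems(2-4) 2(1) by (auto simp: length_remove1)
        fix e j assume j: "j \<in> set (remove1 i bs)"
        have bs: "set (remove1 i bs) = set bs - {i}" using Cons.prems(2) by simp
        have "{e' j |e'. (\<forall>k. k \<notin> set (remove1 i bs) \<longrightarrow> e' k = e k) \<and> (\<exists>x. P (e'(i := x)))}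
          \<subseteq> {e' j |e'. (\<forall>k. k \<notin> set bs \<longrightarrow> e' k = e k) \<and> P e'}"
        proof clarify
          fix e' x assume e': "\<forall>k. k \<notin> set (remove1 i bs) \<longrightarrow> e' k = e k" "P (e'(i := x))"
          show "\<exists>e''. e' j = e'' j \<and> (\<forall>k. k \<notin> set bs \<longrightarrow> e'' k = e k) \<and> P e''"
            using e' j 2(1) bs by (intro exI[of _ "e'(i := x)"]) auto
        qed
        then show "finite {e' j |e'. (\<forall>k. k \<notin> set (remove1 i bs) \<longrightarrow> e' k = e k) \<and>
            (\<exists>x. P (e'(i := x)))}"
          by (rule finite_subset) (rule Cons.prems(5), use j bs in simp)
      qed
      ultimately show False by contradiction
    qed
  qed
qed

end

section \<open>Polynomials without roots\<close>

text \<open>Gaussian elimination on the coefficient of highest index, with pivot \<open>j\<close>.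
  Bounding degrees by vanishing coefficients treats the zero polynomial uniformly and lets the
  induction end at \<open>n = 0\<close>.\<close>

lemma linear_dependence:
  fixes v :: "'b \<Rightarrow> 'a::field poly"
  assumes "finite I" "n < card I" "\<And>i k. i \<in> I \<Longrightarrow> n \<le> k \<Longrightarrow> coeff (v i) k = 0"
  shows "\<exists>c. (\<exists>i\<in>I. c i \<noteq> 0) \<and> (\<Sum>i\<in>I. smult (c i) (v i)) = 0"
  using assms
proof (induction n arbitrary: I v)
  case 0
  then have "v i = 0" if "i \<in> I" for i using that by (auto intro: poly_eqI)
  moreover have "I \<noteq> {}" using 0 by auto
  ultimately show ?case by (intro exI[of _ "\<lambda>_. 1"]) auto
next
  case (Suc n)
  show ?case
  proof (cases "\<forall>i\<in>I. coeff (v i) n = 0")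
    case True
    have "coeff (v i) k = 0" if "i \<in> I" "n \<le> k" for i k
      using True Suc.prems(3)[OF that(1), of k] that by (cases "k = n") auto
    then show ?thesis using Suc.IH[of I v] Suc.prems(1,2) by auto
  next
    case False
    then obtain j where j: "j \<in> I" "coeff (v j) n \<noteq> 0" by blast
    define r where "r i = coeff (v i) n / coeff (v j) n" for i
    define w where "w i = v i - smult (r i) (v j)" for i
    have "coeff (w i) k = 0" if "i \<in> I - {j}" "n \<le> k" for i k
      using Suc.prems(3)[of i k] Suc.prems(3)[of j k] that j by (cases "k = n") (auto simp: w_def r_def)
    moreover have "n < card (I - {j})" using Suc.prems(1,2) j(1) by simp
    ultimately obtain c where c: "\<exists>i\<in>I - {j}. c i \<noteq> 0" "(\<Sum>i\<in>I - {j}. smult (c i) (w i)) = 0"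
      using Suc.IH[of "I - {j}" w] Suc.prems(1) by blast
    define d where "d i = (if i = j then - (\<Sum>i\<in>I - {j}. c i * r i) else c i)" for i
    have "(\<Sum>i\<in>I. smult (d i) (v i)) =
        smult (d j) (v j) + (\<Sum>i\<in>I - {j}. smult (d i) (v i))"
      by (rule sum.remove[OF Suc.prems(1) j(1)])
    also have "(\<Sum>i\<in>I - {j}. smult (d i) (v i)) = (\<Sum>i\<in>I - {j}. smult (c i) (v i))"
      by (rule sum.cong) (auto simp: d_def)
    also have "smult (d j) (v j) = - (\<Sum>i\<in>I - {j}. smult (c i * r i) (v j))"
      by (simp add: d_def smult_sum)
    also have "- (\<Sum>i\<in>I - {j}. smult (c i * r i) (v j)) + (\<Sum>i\<in>I - {j}. smult (c i) (v i)) =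
        (\<Sum>i\<in>I - {j}. smult (c i) (w i))"
      by (simp add: w_def smult_diff_right sum_subtractf)
    finally have "(\<Sum>i\<in>I. smult (d i) (v i)) = 0" using c(2) by simp
    moreover have "\<exists>i\<in>I. d i \<noteq> 0" using c(1) by (auto simp: d_def)
    ultimately show ?thesis by blast
  qed
qed

text \<open>In the field K[X]/(f), with residue classes represented by polynomials of degree below
  that of \<open>f\<close>, roots are split off one at a time. Being monic survives the division and
  keeps \<open>H\<close> nonzero modulo \<open>f\<close>.\<close>

lemma finite_roots_mod:
  fixes f :: "'a::field poly" and H :: "'a poly poly"
  assumes "prime_elem f" "lead_coeff H = 1"
  shows "finite {\<beta>. degree \<beta> < degree f \<and> f dvd poly H \<beta>}"
  using assms(2)
proof (induction "degree H" arbitrary: H)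
  case 0
  then have "H = 1" by (metis degree_eq_zeroE lead_coeff_pCons(2) one_pCons pCons_0_0 coeff_pCons_0)
  then show ?case using assms(1) by (simp add: prime_elem_def)
next
  case (Suc d)
  show ?case
  proof (cases "\<exists>\<alpha>. degree \<alpha> < degree f \<and> f dvd poly H \<alpha>")
    case False
    then have "{\<beta>. degree \<beta> < degree f \<and> f dvd poly H \<beta>} = {}" by blast
    then show ?thesis by (simp only: finite.emptyI)
  next
    case True
    then obtain \<alpha> where \<alpha>: "degree \<alpha> < degree f" "f dvd poly H \<alpha>" by blast
    \<comment> \<open>The remainder \<open>poly H \<alpha>\<close> of this division need not vanish,
      but it is divisible by \<open>f\<close>.\<close>
    define Q where "Q = synthetic_div H \<alpha>"
    have H: "H = [:- \<alpha>, 1:] * Q + [:poly H \<alpha>:]"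
      unfolding Q_def by (rule synthetic_div_correct'[symmetric])
    have "degree Q = d" using Suc.hyps(2) by (simp add: Q_def degree_synthetic_div)
    moreover have "lead_coeff Q = 1"
    proof -
      have "coeff ([:- \<alpha>, 1:] * Q + [:poly H \<alpha>:]) (Suc d) = coeff Q d"
        using \<open>degree Q = d\<close> by (simp add: coeff_eq_0)
      then show ?thesis using Suc.prems Suc.hyps(2) \<open>degree Q = d\<close> H by metis
    qed
    ultimately have fin: "finite {\<beta>. degree \<beta> < degree f \<and> f dvd poly Q \<beta>}"
      using Suc.hyps(1) by blast
    have "\<beta> = \<alpha> \<or> f dvd poly Q \<beta>" if \<beta>: "degree \<beta> < degree f" "f dvd poly H \<beta>" for \<beta>
    proof -
      have "poly H \<beta> = (\<beta> - \<alpha>) * poly Q \<beta> + poly H \<alpha>"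
        by (subst H) (simp add: algebra_simps)
      then have "f dvd (\<beta> - \<alpha>) * poly Q \<beta>" using \<alpha>(2) \<beta>(2) by (metis dvd_add_left_iff)
      then consider "f dvd \<beta> - \<alpha>" | "f dvd poly Q \<beta>"
        using assms(1) by (metis prime_elem_dvd_multD)
      then show ?thesis
      proof cases
        case 1
        have "degree (\<beta> - \<alpha>) < degree f" using \<alpha>(1) \<beta>(1) by (rule degree_diff_less[rotated])
        with 1 have "\<beta> - \<alpha> = 0" by (meson dvd_imp_degree_le leD)
        then show ?thesis by simp
      qed simp
    qed
    then have "{\<beta>. degree \<beta> < degree f \<and> f dvd poly H \<beta>} \<subseteq>
        insert \<alpha> {\<beta>. degree \<beta> < degree f \<and> f dvd poly Q \<beta>}" by blast
    then show ?thesis using fin by (meson finite_insert finite_subset)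
  qed
qed

text \<open>A nontrivial factor has smaller positive degree, hence a root, which would be a root of
  \<open>f\<close>.\<close>

lemma minimal_rootless_prime:
  fixes f :: "'a::field poly"
  assumes "degree f > 0" "\<And>x. poly f x \<noteq> 0"
    and "\<And>g :: 'a poly. 0 < degree g \<Longrightarrow> degree g < degree f \<Longrightarrow> \<exists>x. poly g x = 0"
  shows "prime_elem f"
proof (rule field_poly_irreducible_imp_prime, rule irreducibleI)
  show "f \<noteq> 0" using assms(1) by auto
  then show "\<not> f dvd 1" using assms(1) by (simp add: is_unit_iff_degree)
  fix a b assume ab: "f = a * b"
  then have nz: "a \<noteq> 0" "b \<noteq> 0" using \<open>f \<noteq> 0\<close> by auto
  have "degree a = 0 \<or> degree b = 0"
  proof (rule ccontr)
    assume "\<not> ?thesis"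
    then have "0 < degree a" "degree a < degree f" using ab nz by (auto simp: degree_mult_eq)
    then obtain x where "poly a x = 0" using assms(3)[of a] by blast
    then show False using assms(2)[of x] ab by simp
  qed
  then show "a dvd 1 \<or> b dvd 1" using nz by (auto simp: is_unit_iff_degree)
qed

text \<open>For \<open>n = degree f\<close>, the \<open>n + 1\<close> powers of
  \<open>\<beta>\<close> up to exponent \<open>n\<close> are linearly dependent modulo
  \<open>f\<close>, which yields a nonzero annihilator of degree at most \<open>n\<close>. One of
  least degree is nonconstant and has no root \<open>x\<close>: the factor
  \<open>\<beta> - [:x:]\<close>, nonzero of degree below that of \<open>f\<close>, could be
  cancelled. As polynomials of smaller positive degree have roots, its degree is exactly
  \<open>n\<close>.\<close>

lemma monic_annihilator:
  fixes f \<beta> :: "'a::field poly"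
  assumes f: "\<And>x. poly f x \<noteq> 0"
    "\<And>g :: 'a poly. 0 < degree g \<Longrightarrow> degree g < degree f \<Longrightarrow> \<exists>x. poly g x = 0"
    and \<beta>: "0 < degree \<beta>" "degree \<beta> < degree f"
  obtains G where "degree G = degree f" "lead_coeff G = 1" "\<And>x. poly G x \<noteq> 0" "f dvd pcompose G \<beta>"
proof -
  define n where "n = degree f"
  have prime: "prime_elem f" by (rule minimal_rootless_prime[OF _ f]) (use \<beta> in auto)
  then have "f \<noteq> 0" by auto
  have "coeff (\<beta> ^ i mod f) k = 0" if "n \<le> k" for i k
    using degree_mod_less[OF \<open>f \<noteq> 0\<close>, of "\<beta> ^ i"] that by (auto intro: coeff_eq_0 simp: n_def)
  then obtain c where c: "\<exists>i\<in>{..n}. c i \<noteq> 0" "(\<Sum>i\<le>n. smult (c i) (\<beta> ^ i mod f)) = 0"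
    using linear_dependence[of "{..n}" n "\<lambda>i. \<beta> ^ i mod f"] by auto
  define G0 where "G0 = (\<Sum>i\<le>n. monom (c i) i)"
  have coeff_G0: "coeff G0 k = (if k \<le> n then c k else 0)" for k
    by (simp add: G0_def coeff_sum)
  obtain i where "i \<le> n" "c i \<noteq> 0" using c(1) by auto
  then have "coeff G0 i \<noteq> 0" by (simp add: coeff_G0)
  then have "G0 \<noteq> 0" by auto
  have "degree G0 \<le> n" by (rule degree_le) (simp add: coeff_G0)
  have "poly (map_poly (\<lambda>x. [:x:]) (monom a i)) \<beta> = smult a (\<beta> ^ i)" for a i
    by (simp add: map_poly_monom poly_monom)
  then have "pcompose G0 \<beta> = (\<Sum>i\<le>n. smult (c i) (\<beta> ^ i))"
    unfolding G0_def pcompose_sum by (simp add: pcompose_altdef)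
  also have "\<dots> mod f = (\<Sum>i\<le>n. smult (c i) (\<beta> ^ i) mod f) mod f" by (rule mod_sum_eq[symmetric])
  finally have "pcompose G0 \<beta> mod f = 0" using c(2) by (simp add: mod_smult_left)
  then have G0: "G0 \<noteq> 0 \<and> f dvd pcompose G0 \<beta>" using \<open>G0 \<noteq> 0\<close> by (simp add: dvd_eq_mod_eq_0)
  obtain G where G: "G \<noteq> 0" "f dvd pcompose G \<beta>"
    and least: "\<And>H. H \<noteq> 0 \<Longrightarrow> f dvd pcompose H \<beta> \<Longrightarrow> degree G \<le> degree H"
    using ex_has_least_nat[of "\<lambda>G. G \<noteq> 0 \<and> f dvd pcompose G \<beta>" G0 degree] G0 by blast
  have root: "poly G x \<noteq> 0" for x
  proof
    assume "poly G x = 0"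
    then have "[:- x, 1:] dvd G" by (simp only: poly_eq_0_iff_dvd)
    then obtain H where H: "G = [:- x, 1:] * H" by (elim dvdE)
    then have "H \<noteq> 0" using G(1) by auto
    then have "degree H < degree G" by (simp add: H degree_mult_eq del: mult_pCons_left)
    have "pcompose [:- x, 1:] \<beta> = \<beta> - [:x:]"
      by (intro poly_eqI) (simp add: pcompose_pCons coeff_pCons split: nat.split)
    then have "f dvd (\<beta> - [:x:]) * pcompose H \<beta>"
      using G(2) by (simp only: H pcompose_mult)
    then consider "f dvd \<beta> - [:x:]" | "f dvd pcompose H \<beta>"
      using prime by (metis prime_elem_dvd_multD)
    then show False
    proof cases
      case 1
      have "degree (\<beta> - [:x:]) < degree f" using \<beta> by (intro degree_diff_less) auto
      with 1 have "\<beta> - [:x:] = 0" by (meson dvd_imp_degree_le leD)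
      then show False using \<beta>(1) by simp
    next
      case 2
      then show False using least[OF \<open>H \<noteq> 0\<close>] \<open>degree H < degree G\<close> by simp
    qed
  qed
  have "degree G > 0"
  proof (rule ccontr)
    assume "\<not> ?thesis"
    then obtain a where "G = [:a:]" by (auto elim: degree_eq_zeroE)
    with G have "f dvd [:a:]" "[:a:] \<noteq> 0" by auto
    then have "degree f \<le> degree [:a:]" by (rule dvd_imp_degree_le)
    then show False using \<beta> by simp
  qed
  moreover have "degree G \<le> n" using least[of G0] G0 \<open>degree G0 \<le> n\<close> by auto
  ultimately have "degree G = n" using f(2)[of G] root unfolding n_def by (meson le_neq_implies_less)
  show ?thesis
  proof (rule that[of "smult (inverse (lead_coeff G)) G"])
    show "degree (smult (inverse (lead_coeff G)) G) = degree f"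
      using G(1) \<open>degree G = n\<close> unfolding n_def by (metis degree_smult_eq inverse_zero_imp_zero leading_coeff_0_iff)
    show "lead_coeff (smult (inverse (lead_coeff G)) G) = 1" using G(1) by simp
    show "poly (smult (inverse (lead_coeff G)) G) x \<noteq> 0" for x using root G(1) by simp
    show "f dvd pcompose (smult (inverse (lead_coeff G)) G) \<beta>"
      using G(2) by (simp add: pcompose_smult dvd_smult)
  qed
qed

text \<open>Reduction modulo \<open>f\<close> is linear over the base field, so divisibility is a
  finite system of linear equations in the coefficients of \<open>q\<close>, with constants from the
  reduced monomials. This makes divisibility by \<open>f\<close> definable.\<close>

lemma dvd_iff_coeff_mod:
  fixes f q :: "'a::field poly"
  assumes "f \<noteq> 0" "degree q \<le> m"
  shows "f dvd q \<longleftrightarrow> (\<forall>j\<in>{..degree f}. (\<Sum>i\<le>m. coeff q i * coeff (monom 1 i mod f) j) = 0)"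
proof -
  have "q mod f = (\<Sum>i\<le>m. monom (coeff q i) i) mod f"
    by (simp only: poly_as_sum_of_monoms'[OF assms(2)])
  also have "\<dots> = (\<Sum>i\<le>m. smult (coeff q i) (monom 1 i) mod f) mod f"
    by (simp only: mod_sum_eq smult_monom mult_1_right)
  also have "\<dots> = (\<Sum>i\<le>m. smult (coeff q i) (monom 1 i mod f) mod f) mod f"
    by (simp only: mod_smult_left mod_mod_trivial)
  also have "\<dots> = (\<Sum>i\<le>m. smult (coeff q i) (monom 1 i mod f)) mod f"
    by (simp only: mod_sum_eq)
  also have "\<dots> = (\<Sum>i\<le>m. smult (coeff q i) (monom 1 i mod f) mod f)"
    by (induction m) (simp_all add: poly_mod_add_left)
  finally have "q mod f = (\<Sum>i\<le>m. smult (coeff q i) (monom 1 i mod f))"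
    by (simp only: mod_smult_left mod_mod_trivial)
  then have coeff: "coeff (q mod f) j = (\<Sum>i\<le>m. coeff q i * coeff (monom 1 i mod f) j)" for j
    by (simp add: coeff_sum)
  have "coeff (q mod f) j = 0" if "j > degree f" for j
    using degree_mod_less[OF assms(1), of q] that by (auto intro: coeff_eq_0)
  then have "q mod f = 0 \<longleftrightarrow> (\<forall>j\<in>{..degree f}. coeff (q mod f) j = 0)"
    by (metis atMost_iff coeff_0 leI poly_eq_iff)
  then show ?thesis by (simp only: coeff dvd_eq_mod_eq_0)
qed

section \<open>Definable families of polynomials\<close>

context minimal_unordered_field
begin

text \<open>A family of polynomials indexed by assignments. The degree bound is uniform, so that
  evaluation and divisibility are expressed by one term or one formula for the whole family.\<close>

definition definable_poly :: "((nat \<Rightarrow> 'a) \<Rightarrow> 'a poly) \<Rightarrow> bool" where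
  "definable_poly q \<longleftrightarrow> (\<exists>m. \<forall>e. degree (q e) \<le> m) \<and> (\<forall>i. definable_fun M (\<lambda>e. coeff (q e) i))"

lemma definable_poly_monom:
  assumes "definable_fun M t" shows "definable_poly (\<lambda>e. monom (t e) k)"
  unfolding definable_poly_def
proof (intro conjI exI allI)
  show "degree (monom (t e) k) \<le> k" for e by (rule degree_monom_le)
  show "definable_fun M (\<lambda>e. coeff (monom (t e) k) i)" for i
    by (cases "k = i") (auto intro: assms definable_fun_const)
qed

lemma definable_poly_add:
  assumes "definable_poly p" "definable_poly q" shows "definable_poly (\<lambda>e. p e + q e)"
proof -
  obtain m m' where "\<And>e. degree (p e) \<le> m" "\<And>e. degree (q e) \<le> m'"
    using assms by (auto simp: definable_poly_def)
  then have "degree (p e + q e) \<le> max m m'" for e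
    by (intro degree_add_le) (auto simp: le_max_iff_disj)
  then show ?thesis
    using assms by (auto simp: definable_poly_def intro!: definable_fun_add)
qed

lemma definable_poly_mult:
  assumes "definable_poly p" "definable_poly q" shows "definable_poly (\<lambda>e. p e * q e)"
proof -
  obtain m m' where "\<And>e. degree (p e) \<le> m" "\<And>e. degree (q e) \<le> m'"
    using assms by (auto simp: definable_poly_def)
  then have "degree (p e * q e) \<le> m + m'" for e
    using degree_mult_le[of "p e" "q e"] by (meson add_mono order_trans)
  then show ?thesis
    using assms by (auto simp: definable_poly_def coeff_mult intro!: definable_fun_sum definable_fun_mult)
qed

lemma definable_poly_sum:
  assumes "\<And>i. i \<in> I \<Longrightarrow> definable_poly (p i)" shows "definable_poly (\<lambda>e. \<Sum>i\<in>I. p i e)"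
proof -
  have "definable_poly (\<lambda>e. 0)" using definable_poly_monom[OF definable_fun_const, of 0 0] by simp
  with assms show ?thesis
    by (induction I rule: infinite_finite_induct) (auto intro: definable_poly_add)
qed

lemma definable_poly_power:
  assumes "definable_poly p" shows "definable_poly (\<lambda>e. p e ^ n)"
proof -
  have "definable_poly (\<lambda>e. 1)"
    using definable_poly_monom[OF definable_fun_const, of 1 0] by (simp add: monom_0 one_pCons)
  with assms show ?thesis by (induction n) (auto intro: definable_poly_mult)
qed

lemma definable_poly_smult:
  assumes "definable_fun M t" "definable_poly p" shows "definable_poly (\<lambda>e. smult (t e) (p e))"
  using definable_poly_mult[OF definable_poly_monom[OF assms(1), of 0] assms(2)]
  by (simp add: monom_0)

lemma definable_fun_poly:
  assumes "definable_poly p" "definable_fun M t" shows "definable_fun M (\<lambda>e. poly (p e) (t e))"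
proof -
  obtain m where m: "\<And>e. degree (p e) \<le> m" using assms(1) by (auto simp: definable_poly_def)
  have "poly (p e) x = poly (\<Sum>i\<le>m. monom (coeff (p e) i) i) x" for e x
    by (simp only: poly_as_sum_of_monoms'[OF m])
  then have "poly (p e) x = (\<Sum>i\<le>m. coeff (p e) i * x ^ i)" for e x
    by (simp add: poly_sum poly_monom)
  then show ?thesis using assms
    by (auto simp: definable_poly_def intro!: definable_fun_sum definable_fun_mult definable_fun_power)
qed

lemma definable_pred_dvd:
  assumes "definable_poly q" "f \<noteq> 0" shows "definable_pred M (\<lambda>e. f dvd q e)"
proof -
  obtain m where m: "\<And>e. degree (q e) \<le> m" using assms(1) by (auto simp: definable_poly_def)
  have "definable_fun M (\<lambda>e. coeff (q e) i)" for i
    using assms(1) by (simp add: definable_poly_def)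
  then show ?thesis unfolding dvd_iff_coeff_mod[OF assms(2) m]
    by (intro definable_pred_ball definable_pred_eq definable_fun_sum definable_fun_mult
      definable_fun_const) auto
qed

text \<open>Each value of a nonconstant polynomial is taken finitely often, so the range is
  infinite; being definable, it is cofinite.\<close>

lemma finite_nonvalues:
  fixes g :: "'a poly"
  assumes "degree g > 0" shows "finite {c. \<forall>x. poly g x \<noteq> c}"
proof -
  have "infinite (range (poly g))"
  proof
    assume fin: "finite (range (poly g))"
    have "finite {x. poly g x = c}" for c
    proof -
      have "g - [:c:] \<noteq> 0" using assms by auto
      then have "finite {x. poly (g - [:c:]) x = 0}" by (rule poly_roots_finite)
      then show ?thesis by simp
    qed
    then have "finite (\<Union>c\<in>range (poly g). {x. poly g x = c})" using fin by blast
    moreover have "(\<Union>c\<in>range (poly g). {x. poly g x = c}) = UNIV" by blast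
    ultimately show False using infinite_univ by simp
  qed
  moreover have "definable_poly (\<lambda>e. g)"
    unfolding definable_poly_def by (auto intro: definable_fun_const)
  then have "definable_pred M (\<lambda>e. poly g (e 1) = e 0)"
    by (intro definable_pred_eq definable_fun_poly definable_fun_var)
  from definable_pred_ex[OF this, of 1]
  have P: "definable_pred M (\<lambda>e. \<exists>x. poly g x = e 0)" by simp
  have "{c. \<exists>x. poly g x = c} = range (poly g)" by auto
  ultimately show ?thesis using finite_or_cofinite[OF P, of "\<lambda>_. 0" 0] by simp
qed

section \<open>Contradiction from a rootless polynomial of least degree\<close>

lemma algebraically_closed:
  fixes p :: "'a poly"
  assumes "degree p > 0" shows "\<exists>x. poly p x = 0"
proof (rule ccontr)
  assume "\<not> ?thesis"
  then obtain f :: "'a poly" where f: "degree f > 0" "\<And>x. poly f x \<noteq> 0"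
    and least: "\<And>g :: 'a poly. degree g > 0 \<Longrightarrow> (\<And>x. poly g x \<noteq> 0) \<Longrightarrow> degree f \<le> degree g"
    using ex_has_least_nat[of "\<lambda>g. degree g > 0 \<and> (\<forall>x. poly g x \<noteq> 0)" p degree] assms by blast
  have roots: "\<exists>x. poly g x = 0" if "0 < degree g" "degree g < degree f" for g :: "'a poly"
    using least[OF that(1)] that(2) by (meson leD)
  have "f \<noteq> 0" using f(1) by auto
  have prime: "prime_elem f" by (rule minimal_rootless_prime[OF f roots])
  define n where "n = degree f"
  have "n \<noteq> 1"
  proof
    assume "n = 1"
    then obtain a b where "f = [:a, b:]" "b \<noteq> 0"
      by (metis n_def One_nat_def degree1_coeffs)
    then have "poly f (- a / b) = 0" by simp
    then show False using f(2) by blast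
  qed
  then have n: "n \<ge> 2" using f(1) by (simp add: n_def)
  \<comment> \<open>Variables \<open>0\<close> to \<open>n - 1\<close> hold the coefficients of a
    representative \<open>B e\<close> in K[X]/(f). Variables \<open>n\<close> to
    \<open>2 * n - 1\<close> hold those of the monic polynomial \<open>G e\<close> below the leading
    one, with the constant coefficient at \<open>n\<close>.\<close>
  define B where "B e = (\<Sum>i<n. monom (e i) i)" for e :: "nat \<Rightarrow> 'a"
  define G where "G e = monom 1 n + (\<Sum>k<n. monom (e (n + k)) k)" for e :: "nat \<Rightarrow> 'a"
  have coeff_B: "coeff (B e) i = (if i < n then e i else 0)" for e i
    by (simp add: B_def coeff_sum)
  have coeff_G: "coeff (G e) i = (if i < n then e (n + i) else if i = n then 1 else 0)" for e i
    by (simp add: G_def coeff_sum)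
  have degree_B: "degree (B e) < degree f" for e
  proof -
    have "degree (B e) \<le> n - 1" by (rule degree_le) (auto simp: coeff_B)
    then show ?thesis using n by (simp add: n_def)
  qed
  have degree_G: "degree (G e) = n" for e
    by (rule antisym[OF degree_le le_degree]) (simp_all add: coeff_G)
  have G_subst: "pcompose (G e) (B e) = B e ^ n + (\<Sum>k<n. smult (e (n + k)) (B e ^ k))" for e
  proof -
    have "pcompose (monom a k) q = smult a (q ^ k)" for a :: 'a and k q
      by (simp add: pcompose_altdef map_poly_monom poly_monom)
    then show ?thesis by (simp add: G_def pcompose_add pcompose_sum)
  qed
  have G: "definable_poly G"
    unfolding G_def[abs_def]
    by (intro definable_poly_add definable_poly_sum definable_poly_monom definable_fun_const
      definable_fun_var)
  have B: "definable_poly B"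
    unfolding B_def[abs_def] by (intro definable_poly_sum definable_poly_monom definable_fun_var)
  define P where "P e \<longleftrightarrow> (\<forall>x. poly (G e) x \<noteq> 0) \<and> f dvd pcompose (G e) (B e)" for e
  have "definable_pred M (\<lambda>e. f dvd pcompose (G e) (B e))"
    unfolding G_subst
    by (intro definable_pred_dvd \<open>f \<noteq> 0\<close> definable_poly_add definable_poly_sum
      definable_poly_smult definable_poly_power B definable_fun_var)
  moreover have "definable_pred M (\<lambda>e. \<forall>x. poly (G e) x \<noteq> 0)"
  proof -
    have "definable_pred M (\<lambda>e. poly (G e) (e (2 * n)) \<noteq> 0)"
      by (intro definable_pred_neg definable_pred_eq definable_fun_poly definable_fun_var
        definable_fun_const G)
    from definable_pred_all[OF this, of "2 * n"] show ?thesis by (simp add: G_def)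
  qed
  ultimately have P: "definable_pred M P"
    unfolding P_def[abs_def] by (intro definable_pred_conj)
  \<comment> \<open>The constant coefficient of \<open>G\<close> is projected away, which leaves
    \<open>n - 1\<close> variables against the \<open>n\<close> coefficients of
    \<open>B\<close>.\<close>
  define Q where "Q e \<longleftrightarrow> (\<exists>y. P (e(n := y)))" for e
  have Q: "definable_pred M Q" unfolding Q_def[abs_def] by (rule definable_pred_ex[OF P])

  have "\<not> almost_all [0..<n] (exists_on [n + 1..<2 * n] Q) (\<lambda>_. 0)"
  proof (rule no_finite_fibres[OF Q])
    fix e :: "nat \<Rightarrow> 'a" and i assume "i \<in> set [0..<n]"
    then have i: "i < n" by simp
    \<comment> \<open>\<open>h\<close> is \<open>G\<close> with constant coefficient zero. It is the
      same throughout one fibre, and a value \<open>y\<close> at \<open>n\<close> just adds a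
      constant.\<close>
    define h where "h = G (e(n := 0))"
    have G_eq: "G (e'(n := y)) = h + [:y:]" if "\<forall>j. j \<notin> set [0..<n] \<longrightarrow> e' j = e j" for e' y
    proof (rule poly_eqI)
      fix k show "coeff (G (e'(n := y))) k = coeff (h + [:y:]) k"
        using that n by (auto simp: h_def coeff_G coeff_pCons split: nat.split)
    qed
    \<comment> \<open>\<open>Y\<close> holds the admissible constant coefficients, which are
      negatives of values omitted by \<open>h\<close>, and \<open>Z y\<close> the roots modulo
      \<open>f\<close> for one of them. Both are finite, hence so is the fibre.\<close>
    define Y where "Y = {y. \<forall>x. poly (h + [:y:]) x \<noteq> 0}"
    define Z where "Z y = {\<beta>. degree \<beta> < degree f \<and> f dvd pcompose (h + [:y:]) \<beta>}" for y
    have "finite {c. \<forall>x. poly h x \<noteq> c}"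
      by (rule finite_nonvalues) (use n in \<open>simp add: h_def degree_G\<close>)
    moreover have "Y \<subseteq> uminus ` {c. \<forall>x. poly h x \<noteq> c}"
    proof
      fix y assume "y \<in> Y"
      then have "- y \<in> {c. \<forall>x. poly h x \<noteq> c}"
        by (auto simp: Y_def eq_neg_iff_add_eq_0)
      then show "y \<in> uminus ` {c. \<forall>x. poly h x \<noteq> c}" by (metis imageI minus_minus)
    qed
    ultimately have "finite Y" by (meson finite_imageI finite_subset)
    moreover have "finite (Z y)" for y
    proof -
      have h: "h + [:y:] = G (e(n := y))" by (simp add: G_eq)
      have "lead_coeff (map_poly (\<lambda>x. [:x:]) (h + [:y:])) = 1"
        unfolding h by (simp add: degree_map_poly degree_G coeff_map_poly coeff_G one_pCons)
      from finite_roots_mod[OF prime this] show ?thesis by (simp add: Z_def pcompose_altdef)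
    qed
    ultimately have "finite ((\<lambda>\<beta>. coeff \<beta> i) ` (\<Union>y\<in>Y. Z y))" by blast
    moreover have "{e' i |e'. (\<forall>j. j \<notin> set [0..<n] \<longrightarrow> e' j = e j) \<and> Q e'} \<subseteq>
        (\<lambda>\<beta>. coeff \<beta> i) ` (\<Union>y\<in>Y. Z y)"
    proof clarify
      fix e' assume e': "\<forall>j. j \<notin> set [0..<n] \<longrightarrow> e' j = e j" "Q e'"
      then obtain y where "P (e'(n := y))" unfolding Q_def by blast
      then have "y \<in> Y" "B (e'(n := y)) \<in> Z y"
        using degree_B unfolding P_def Y_def Z_def G_eq[OF e'(1)] by simp_all
      moreover have "e' i = coeff (B (e'(n := y))) i" using i by (simp add: coeff_B)
      ultimately show "e' i \<in> (\<lambda>\<beta>. coeff \<beta> i) ` (\<Union>y\<in>Y. Z y)" by blast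
    qed
    ultimately show "finite {e' i |e'. (\<forall>j. j \<notin> set [0..<n] \<longrightarrow> e' j = e j) \<and> Q e'}"
      by (rule finite_subset[rotated])
  qed (use n in auto)

  \<comment> \<open>A nonzero coefficient at index 1, available because \<open>n \<ge> 2\<close>,
    makes \<open>B e\<close> nonconstant, as \<open>monic_annihilator\<close> requires.\<close>
  moreover have "exists_on [n + 1..<2 * n] Q e" if "e 1 \<noteq> 0" for e
  proof -
    have "1 \<le> degree (B e)" by (rule le_degree) (use that n in \<open>simp add: coeff_B\<close>)
    then have "0 < degree (B e)" by simp
    then obtain H where H: "degree H = degree f" "lead_coeff H = 1" "\<And>x. poly H x \<noteq> 0"
        "f dvd pcompose H (B e)"
      using monic_annihilator[OF f(2) roots \<open>0 < degree (B e)\<close> degree_B] by blast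
    define e' where "e' j = (if n \<le> j \<and> j < 2 * n then coeff H (j - n) else e j)" for j
    have "G e' = H"
    proof (rule poly_eqI)
      fix k show "coeff (G e') k = coeff H k"
        using H(1,2) by (auto simp: coeff_G e'_def n_def coeff_eq_0 not_less)
    qed
    moreover have "B e' = B e" by (simp add: B_def e'_def)
    ultimately have "P e'" using H(3,4) by (simp add: P_def)
    \<comment> \<open>\<open>Q\<close> quantifies over variable \<open>n\<close> itself, so
      \<open>e'\<close> is reset there in order to differ from \<open>e\<close> only on
      \<open>[n + 1..<2 * n]\<close>.\<close>
    then have "P ((e'(n := e n))(n := e' n))" by simp
    then have "Q (e'(n := e n))" unfolding Q_def by blast
    moreover have "\<forall>j. j \<notin> set [n + 1..<2 * n] \<longrightarrow> (e'(n := e n)) j = e j"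
      by (auto simp: e'_def)
    ultimately show ?thesis unfolding exists_on_iff by blast
  qed
  \<comment> \<open>The condition on \<open>e 1\<close> holds generically, so almost every tuple has
    a witness, which the finite fibres exclude.\<close>
  moreover have "almost_all [0..<n] (\<lambda>e. e 1 \<noteq> 0) (\<lambda>_. 0)"
    by (rule almost_all_not_in) (use n in auto)
  ultimately show False using almost_all_mono by blast
qed

end

theorem theorem1:
  fixes M :: "('a :: field, 'f, 'r) fo_structure"
  assumes "minimal_field M"
    and "\<not> ordered_structure M"
  shows "\<forall>p :: 'a poly. degree p > 0 \<longrightarrow> (\<exists>x. poly p x = 0)"
proof -
  interpret minimal_unordered_field M
    using assms by unfold_locales
  show ?thesis using algebraically_closed by blast
qed

end
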